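(* There is a constant $r^*>0$ such that if a finite family $\mathcal P$ of planar planks covers the annulus $D\setminus (r^*D)$, then \[ \sum_{P\in\mathcal P} w(P)\ge 2 . \]
   Context: $D=\{x\in\mathbb R^2:\|x\|\le 1\}$ is the closed unit disk and $r^*D=\{r^*x: x\in D\}$. A plank $P$ in $\mathbb R^2$ is the closed region between two parallel lines, and its width $w(P)$ is the distance between these lines. A family covers a set if the set is contained in the union of the family. *)

theory Defs
  imports "HOL-Analysis.Analysis"
begin

definition line :: "real^2 \<Rightarrow> real \<Rightarrow> (real^2) set" where
  "line u a = {x. u \<bullet> x = a}"

definition slab :: "real^2 \<Rightarrow> real \<Rightarrow> real \<Rightarrow> (real^2) set" where
  "slab u a b = {x. a \<le> u \<bullet> x \<and> u \<bullet> x \<le> b}"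

text \<open>The two bounding lines are \<open>line u a\<close> and \<open>line u b\<close>. They may coincide:
  a single line is a plank of width 0. The empty set is not a plank.\<close>

definition plank :: "(real^2) set \<Rightarrow> bool" where
  "plank P \<longleftrightarrow> (\<exists>u a b. norm u = 1 \<and> a \<le> b \<and> P = slab u a b)"

text \<open>The value does not depend on the representation of \<open>P\<close>;
  see \<open>width_slab\<close> below.\<close>

definition width :: "(real^2) set \<Rightarrow> real" where
  "width P = (THE w. \<exists>u a b. norm u = 1 \<and> a \<le> b \<and> P = slab u a b
                       \<and> w = setdist (line u a) (line u b))"

abbreviation unit_disk :: "(real^2) set" where
  "unit_disk \<equiv> cball 0 1"

lemma setdist_lines:
  assumes "norm u = 1" "a \<le> b"
  shows "setdist (line u a) (line u b) = b - a"
proof (rule antisym)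
  have uu: "u \<bullet> u = 1"
    using assms(1) by (simp add: dot_square_norm)
  have mem: "c *\<^sub>R u \<in> line u c" for c
    by (simp add: line_def uu)
  have "setdist (line u a) (line u b) \<le> dist (a *\<^sub>R u) (b *\<^sub>R u)"
    by (rule setdist_le_dist[OF mem mem])
  also have "\<dots> = b - a"
    using assms by (simp add: dist_norm flip: scaleR_left_diff_distrib)
  finally show "setdist (line u a) (line u b) \<le> b - a" .
  show "b - a \<le> setdist (line u a) (line u b)"
  proof (rule le_setdistI)
    show "line u a \<noteq> {}" "line u b \<noteq> {}"
      using mem by blast+
    fix x y assume "x \<in> line u a" "y \<in> line u b"
    then have "b - a = u \<bullet> (y - x)"
      by (simp add: line_def inner_diff_right)
    also have "\<dots> \<le> norm u * norm (y - x)"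
      by (rule norm_cauchy_schwarz)
    finally show "b - a \<le> dist x y"
      using assms(1) by (simp add: dist_norm norm_minus_commute)
  qed
qed

lemma slab_width_le:
  assumes "norm u = 1" "norm v = 1" "c \<le> d" "slab u a b = slab v c d"
  shows "d - c \<le> b - a"
proof -
  have vv: "v \<bullet> v = 1"
    using assms(2) by (simp add: dot_square_norm)
  define w where "w = v - (u \<bullet> v) *\<^sub>R u"
  have uu: "u \<bullet> u = 1"
    using assms(1) by (simp add: dot_square_norm)
  have uw: "u \<bullet> w = 0"
    by (simp add: w_def inner_diff_right uu)
  have "v \<bullet> w = 0"
  proof (rule ccontr)
    assume nz: "v \<bullet> w \<noteq> 0"
    have "c *\<^sub>R v \<in> slab u a b"
      using assms by (simp add: slab_def vv)
    then have "c *\<^sub>R v + t *\<^sub>R w \<in> slab v c d" for t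
      using uw unfolding assms(4)[symmetric] by (simp add: slab_def inner_add_right)
    then have "c + t * (v \<bullet> w) \<le> d" for t
      by (simp add: slab_def inner_add_right vv)
    from this[of "(d - c + 1) / (v \<bullet> w)"] show False
      using nz by simp
  qed
  moreover have "w \<bullet> w = v \<bullet> w - (u \<bullet> v) * (u \<bullet> w)"
    by (subst (1) w_def) (simp add: inner_diff_left)
  ultimately have "w = 0"
    using uw by simp
  then have v: "v = (u \<bullet> v) *\<^sub>R u"
    by (simp add: w_def)
  then have "\<bar>u \<bullet> v\<bar> = 1"
    using assms(1,2) by (metis mult.right_neutral norm_scaleR)
  moreover have "c *\<^sub>R v \<in> slab u a b" "d *\<^sub>R v \<in> slab u a b"
    using assms by (auto simp: slab_def vv)
  ultimately show ?thesis
    by (auto simp: slab_def abs_if split: if_splits)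
qed

lemma width_slab:
  assumes "norm u = 1" "a \<le> b"
  shows "width (slab u a b) = b - a"
  unfolding width_def
proof (rule the_equality)
  show "\<exists>u' a' b'. norm u' = 1 \<and> a' \<le> b' \<and> slab u a b = slab u' a' b'
          \<and> b - a = setdist (line u' a') (line u' b')"
    using assms setdist_lines by metis
next
  fix w
  assume "\<exists>u' a' b'. norm u' = 1 \<and> a' \<le> b' \<and> slab u a b = slab u' a' b'
            \<and> w = setdist (line u' a') (line u' b')"
  then obtain u' a' b' where *: "norm u' = 1" "a' \<le> b'" "slab u a b = slab u' a' b'"
      "w = setdist (line u' a') (line u' b')"
    by blast
  have "b' - a' \<le> b - a" "b - a \<le> b' - a'"
    using slab_width_le[of u u' a' b' a b] slab_width_le[of u' u a b a' b'] assms * by auto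
  then show "w = b - a"
    using * setdist_lines by simp
qed

end

theory Submission
  imports Defs
begin

text \<open>
Write the planks as \<open>\<bar>u\<^sub>i \<bullet> x - b\<^sub>i\<bar> \<le> h\<^sub>i\<close> with unit normals \<open>u\<^sub>i\<close>, and suppose that the half-widths have sum less than 1.
A point of the annulus that no plank contains has to be found.

For the full disk this is Bang's argument. Among all signs \<open>\<epsilon>\<close> take those that maximize
\<open>\<bar>p\<bar>\<^sup>2 - 2 \<Sum> \<epsilon>\<^sub>i h\<^sub>i b\<^sub>i\<close>, where \<open>p = \<Sum> \<epsilon>\<^sub>i h\<^sub>i u\<^sub>i\<close>. That no single flip of a sign increases this
number means exactly \<open>\<epsilon>\<^sub>i (u\<^sub>i \<bullet> p - b\<^sub>i) \<ge> h\<^sub>i\<close>, so \<open>p\<close> is missed, and \<open>\<bar>p\<bar> \<le> \<Sum> h\<^sub>i < 1\<close>.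
The point \<open>p\<close> may lie in the hole, however. Let \<open>M\<close> be the largest length of a vector
\<open>\<Sum> \<epsilon>\<^sub>i h\<^sub>i u\<^sub>i\<close> and \<open>D = 1 - M\<close>.

If \<open>D\<close> is not tiny, all sums \<open>p\<close> stay away from the rim, and the additional convex term \<open>2 r \<bar>p\<bar>\<close> in the
functional moves the missed point radially outwards by \<open>r\<close> (\<open>bang_pushed\<close>).

If \<open>D\<close> is tiny, the planks are nearly parallel. Take the maximizing vector as vertical axis and orient the
normals by its signs: \<open>u\<^sub>i = (s\<^sub>i, c\<^sub>i)\<close> with \<open>c\<^sub>i \<ge> 0\<close>, \<open>\<Sum> h\<^sub>i s\<^sub>i = 0\<close>, \<open>\<Sum> h\<^sub>i c\<^sub>i = 1 - D\<close> and therefore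
\<open>\<Sum> h\<^sub>i s\<^sub>i\<^sup>2 \<le> 2 D\<close>. Bang's point now lies near the vertical diameter, and near the poles
\<open>(0, -1)\<close>, \<open>(0, 1)\<close> there is hardly room for a push. So the diameter is replaced by a broken line that
goes from one pole to the other and passes the hole at a distance, with a kink at \<open>(R, \<kappa>)\<close>. Bang's argument is affine
invariant, so on each of the two segments it can be run in sheared coordinates that make the segment vertical:
if the segment moves to the left by \<open>v\<close> per unit of height, the normal \<open>(s, c)\<close> becomes \<open>(s, c - v s)\<close>. Three observations
make the two halves fit together.

\<^item> The height that Bang's point can reach is the sum of the vertical extents of the planks, \<open>\<Sum> h\<^sub>i c\<^sub>i = 1 - D\<close>
without a shear. To first order it changes by \<open>\<Sum> h\<^sub>i v\<^sub>i s\<^sub>i\<close>, where \<open>v\<^sub>i\<close> belongs to the segment that the plank crosses.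
Since \<open>\<Sum> h\<^sub>i s\<^sub>i = 0\<close>, this is essentially a negative multiple of the sum of
\<open>h\<^sub>i s\<^sub>i\<close> over the planks below the kink, and reflection in the vertical axis changes its sign. So
one of the two ways around the hole essentially does not increase it. The second order terms are
\<open>O(R \<Sum> h\<^sub>i s\<^sub>i\<^sup>2) = O(R D)\<close>, which for small constant \<open>R\<close> is less than the room \<open>D\<close> that is left at the poles.

\<^item> Planks that pass near the kink belong to neither segment. They get both treatments: there are two functionals,
one for each segment, which differ only on these planks, and the signs maximize the larger one. A small
vertical shift of order \<open>R D\<close> makes sure that the functional that wins has its point on its own side of the
kink (\<open>missed_point_given_kink\<close>). All other planks that are treated for the wrong segment are too far away to matter.

\<^item> The cost of this is proportional to the sum of \<open>h\<^sub>i \<bar>s\<^sub>i\<bar>\<close> over the planks near the kink, which is \<open>O(D)\<close> for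
a suitable \<open>\<kappa>\<close>, by averaging over the heights in \<open>[-1/4, 1/4]\<close> (\<open>exists_kink_height\<close>).

The averaging needs planks that are thin compared with \<open>sqrt D\<close>. A wide plank is cut into thin parallel ones, which are
enlarged a little so that the common boundary lines are missed as well (\<open>uncovered_point\<close>).
\<close>

section \<open>Sign vectors and single flips\<close>

definition signs :: "'i set \<Rightarrow> ('i \<Rightarrow> real) set" where
  "signs I = (I \<rightarrow>\<^sub>E {-1, 1})"

lemma signs_cases: "\<epsilon> \<in> signs I \<Longrightarrow> i \<in> I \<Longrightarrow> \<epsilon> i = -1 \<or> \<epsilon> i = 1"
  by (auto simp: signs_def PiE_iff)

lemma signs_flip: "\<epsilon> \<in> signs I \<Longrightarrow> i \<in> I \<Longrightarrow> \<epsilon>(i := - \<epsilon> i) \<in> signs I"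
  by (auto simp: signs_def PiE_iff extensional_def)

lemma ones_in_signs: "(\<lambda>i\<in>I. 1) \<in> signs I"
  by (auto simp: signs_def)

lemma signs_maximizer:
  fixes F :: "('i \<Rightarrow> real) \<Rightarrow> real"
  assumes "finite I"
  obtains \<epsilon> where "\<epsilon> \<in> signs I" "\<And>\<epsilon>'. \<epsilon>' \<in> signs I \<Longrightarrow> F \<epsilon>' \<le> F \<epsilon>"
proof -
  have fin: "finite (signs I)"
    unfolding signs_def using assms by (intro finite_PiE) auto
  have ne: "signs I \<noteq> {}"
    using ones_in_signs by blast
  have "Max (F ` signs I) \<in> F ` signs I"
    using fin ne by (intro Max_in) auto
  then obtain \<epsilon> where "\<epsilon> \<in> signs I" "F \<epsilon> = Max (F ` signs I)"
    by auto
  then show ?thesis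
    using fin by (intro that[of \<epsilon>]) auto
qed

lemma sum_flip:
  fixes a :: "'i \<Rightarrow> 'v::real_vector"
  assumes "finite I" "i \<in> I"
  shows "(\<Sum>j\<in>I. (\<epsilon>(i := - \<epsilon> i)) j *\<^sub>R a j) = (\<Sum>j\<in>I. \<epsilon> j *\<^sub>R a j) - (2 * \<epsilon> i) *\<^sub>R a i"
proof -
  have "(\<Sum>j\<in>I. (\<epsilon>(i := - \<epsilon> i)) j *\<^sub>R a j) = (- \<epsilon> i) *\<^sub>R a i + (\<Sum>j\<in>I-{i}. \<epsilon> j *\<^sub>R a j)"
    using assms by (subst sum.remove[of _ i]) (auto intro!: sum.cong)
  moreover have "(\<Sum>j\<in>I. \<epsilon> j *\<^sub>R a j) = \<epsilon> i *\<^sub>R a i + (\<Sum>j\<in>I-{i}. \<epsilon> j *\<^sub>R a j)"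
    using assms by (subst sum.remove[of _ i]) auto
  moreover have "(2 * \<epsilon> i) *\<^sub>R a i = \<epsilon> i *\<^sub>R a i + \<epsilon> i *\<^sub>R a i"
    by (simp flip: scaleR_left_distrib)
  ultimately show ?thesis by simp
qed

lemma sum_flip_real:
  fixes a :: "'i \<Rightarrow> real"
  assumes "finite I" "i \<in> I"
  shows "(\<Sum>j\<in>I. (\<epsilon>(i := - \<epsilon> i)) j * a j) = (\<Sum>j\<in>I. \<epsilon> j * a j) - 2 * \<epsilon> i * a i"
  using sum_flip[OF assms, of \<epsilon> a] by simp

section \<open>Bang's argument\<close>

text \<open>
Bang's step for one index, in coordinates: \<open>(w\<^sub>i, C\<^sub>i)\<close> is the normal of the \<open>i\<close>-th plank, of any length, \<open>m\<^sub>i\<close> its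
offset and \<open>(P, y)\<close> the point that is produced. A flip of \<open>\<epsilon>\<^sub>i\<close> changes the functional by
\<open>4 t\<^sub>i (t\<^sub>i (C\<^sub>i\<^sup>2 + w\<^sub>i\<^sup>2) - \<epsilon>\<^sub>i (C\<^sub>i y + w\<^sub>i P - m\<^sub>i))\<close>. The shift \<open>\<beta>\<close> of the height is free because it
contributes only a linear term to the functional.
\<close>
lemma bang_step:
  fixes t C w m :: "'i \<Rightarrow> real" and \<beta> \<gamma> :: real and I :: "'i set"
  defines "F \<equiv> \<lambda>\<epsilon>. ((\<Sum>j\<in>I. \<epsilon> j * (t j * C j)) + \<beta>)\<^sup>2 + (\<Sum>j\<in>I. \<epsilon> j * (t j * w j))\<^sup>2
                    - 2 * (\<Sum>j\<in>I. \<epsilon> j * (t j * m j)) + \<gamma>"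
  assumes I: "finite I" "i \<in> I" and sign: "\<epsilon> \<in> signs I" and t: "t i > 0"
    and max: "F (\<epsilon>(i := - \<epsilon> i)) \<le> F \<epsilon>"
  shows "t i * ((C i)\<^sup>2 + (w i)\<^sup>2) \<le>
         \<epsilon> i * (C i * ((\<Sum>j\<in>I. \<epsilon> j * (t j * C j)) + \<beta>) + w i * (\<Sum>j\<in>I. \<epsilon> j * (t j * w j)) - m i)"
proof -
  define y where "y = (\<Sum>j\<in>I. \<epsilon> j * (t j * C j)) + \<beta>"
  define P where "P = (\<Sum>j\<in>I. \<epsilon> j * (t j * w j))"
  define N where "N = (\<Sum>j\<in>I. \<epsilon> j * (t j * m j))"
  have e: "\<epsilon> i * \<epsilon> i = 1"
    using signs_cases[OF sign I(2)] by auto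
  have F0: "F \<epsilon> = y\<^sup>2 + P\<^sup>2 - 2 * N + \<gamma>"
    by (simp add: F_def y_def P_def N_def)
  have "F (\<epsilon>(i := - \<epsilon> i)) = (y - 2 * \<epsilon> i * (t i * C i))\<^sup>2 + (P - 2 * \<epsilon> i * (t i * w i))\<^sup>2
          - 2 * (N - 2 * \<epsilon> i * (t i * m i)) + \<gamma>"
    unfolding F_def y_def P_def N_def sum_flip_real[OF I, of \<epsilon> "\<lambda>j. t j * C j"]
      sum_flip_real[OF I, of \<epsilon> "\<lambda>j. t j * w j"] sum_flip_real[OF I, of \<epsilon> "\<lambda>j. t j * m j"]
    by (simp add: diff_add_eq)
  also have "\<dots> = F \<epsilon> - 4 * t i * (\<epsilon> i * (C i * y + w i * P - m i))
        + 4 * (\<epsilon> i * \<epsilon> i) * (t i)\<^sup>2 * ((C i)\<^sup>2 + (w i)\<^sup>2)"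
    unfolding F0 by (simp add: power2_eq_square algebra_simps)
  finally have "4 * t i * (t i * ((C i)\<^sup>2 + (w i)\<^sup>2)) \<le> 4 * t i * (\<epsilon> i * (C i * y + w i * P - m i))"
    using max e by (simp add: power2_eq_square algebra_simps)
  then show ?thesis
    using t unfolding y_def P_def by simp
qed

text \<open>
The functional is \<open>\<bar>p\<bar>\<^sup>2 + 2 r \<bar>p\<bar> - 2 \<Sum> \<epsilon>\<^sub>i h\<^sub>i b\<^sub>i\<close>. By convexity, \<open>\<bar>p - d\<bar> \<ge> \<bar>p\<bar> - d \<bullet> e\<close> for the
direction \<open>e\<close> of \<open>p\<close>, so its linearization at a maximizer gives Bang's inequalities at \<open>x = p + r e\<close>.
\<close>
lemma bang_pushed:
  fixes u :: "'i \<Rightarrow> 'v::euclidean_space"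
  assumes I: "finite I" and u: "\<And>i. i \<in> I \<Longrightarrow> norm (u i) = 1" and h: "\<And>i. i \<in> I \<Longrightarrow> h i > 0"
    and r: "r \<ge> 0" and M: "\<And>\<epsilon>. \<epsilon> \<in> signs I \<Longrightarrow> norm (\<Sum>i\<in>I. \<epsilon> i *\<^sub>R (h i *\<^sub>R u i)) \<le> M"
  shows "\<exists>x. r \<le> norm x \<and> norm x \<le> M + r \<and> (\<forall>i\<in>I. h i \<le> \<bar>u i \<bullet> x - b i\<bar>)"
proof -
  define p where "p = (\<lambda>\<epsilon>. \<Sum>i\<in>I. \<epsilon> i *\<^sub>R (h i *\<^sub>R u i))"
  define F where "F = (\<lambda>\<epsilon>. (norm (p \<epsilon>))\<^sup>2 + 2 * r * norm (p \<epsilon>) - 2 * (\<Sum>i\<in>I. \<epsilon> i * (h i * b i)))"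
  obtain \<epsilon> where \<epsilon>: "\<epsilon> \<in> signs I" and max: "\<And>\<epsilon>'. \<epsilon>' \<in> signs I \<Longrightarrow> F \<epsilon>' \<le> F \<epsilon>"
    using signs_maximizer[OF I, of F] by blast
  \<comment> \<open>at \<open>p = 0\<close> every unit vector is a subgradient of the norm, so any direction will do\<close>
  obtain e0 :: 'v where "norm e0 = 1"
    using vector_choose_size[of 1] by auto
  define e where "e = (if p \<epsilon> = 0 then e0 else p \<epsilon> /\<^sub>R norm (p \<epsilon>))"
  have e: "norm e = 1" and pe: "p \<epsilon> = norm (p \<epsilon>) *\<^sub>R e"
    using \<open>norm e0 = 1\<close> by (auto simp: e_def)
  define x where "x = p \<epsilon> + r *\<^sub>R e"
  have "x = (norm (p \<epsilon>) + r) *\<^sub>R e"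
    unfolding x_def using pe by (metis scaleR_left_distrib)
  then have nx: "norm x = norm (p \<epsilon>) + r"
    using e r by simp
  have "h i \<le> \<bar>u i \<bullet> x - b i\<bar>" if i: "i \<in> I" for i
  proof -
    define d where "d = (2 * \<epsilon> i) *\<^sub>R (h i *\<^sub>R u i)"
    have ee: "\<epsilon> i * \<epsilon> i = 1" "\<bar>\<epsilon> i\<bar> = 1"
      using signs_cases[OF \<epsilon> i] by auto
    have uu: "u i \<bullet> u i = 1"
      using u[OF i] by (simp add: dot_square_norm)
    have flip: "p (\<epsilon>(i := - \<epsilon> i)) = p \<epsilon> - d"
      unfolding p_def d_def by (rule sum_flip[OF I i])
    have "(p \<epsilon> - d) \<bullet> e \<le> norm (p \<epsilon> - d) * norm e"
      by (rule norm_cauchy_schwarz)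
    moreover have "p \<epsilon> \<bullet> e = norm (p \<epsilon>)"
      using e by (subst pe) (simp add: dot_square_norm)
    ultimately have ge: "norm (p \<epsilon>) - d \<bullet> e \<le> norm (p \<epsilon> - d)"
      using e by (simp add: inner_diff_left)
    have "F (\<epsilon>(i := - \<epsilon> i)) = (norm (p \<epsilon> - d))\<^sup>2 + 2 * r * norm (p \<epsilon> - d)
            - 2 * ((\<Sum>i\<in>I. \<epsilon> i * (h i * b i)) - 2 * \<epsilon> i * (h i * b i))"
      unfolding F_def flip by (subst sum_flip_real[OF I i]) simp
    moreover have "(norm (p \<epsilon> - d))\<^sup>2 = (norm (p \<epsilon>))\<^sup>2 - 2 * (p \<epsilon> \<bullet> d) + d \<bullet> d"
      by (simp add: power2_norm_eq_inner inner_diff_left inner_diff_right inner_commute)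
    moreover have "2 * r * norm (p \<epsilon> - d) \<ge> 2 * r * (norm (p \<epsilon>) - d \<bullet> e)"
      using ge r by (intro mult_left_mono) auto
    moreover have "F (\<epsilon>(i := - \<epsilon> i)) \<le> F \<epsilon>"
      by (rule max[OF signs_flip[OF \<epsilon> i]])
    ultimately have "d \<bullet> d + 4 * \<epsilon> i * (h i * b i) \<le> 2 * (p \<epsilon> \<bullet> d) + 2 * r * (d \<bullet> e)"
      unfolding F_def by (simp add: algebra_simps)
    also have "\<dots> = 2 * (x \<bullet> d)"
      by (simp add: x_def inner_add_left inner_commute algebra_simps)
    also have "\<dots> = 4 * h i * (\<epsilon> i * (u i \<bullet> x))"
      by (simp add: d_def inner_commute)
    also have "d \<bullet> d = 4 * h i * h i * (\<epsilon> i * \<epsilon> i)"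
      by (simp add: d_def uu)
    finally have "4 * h i * h i \<le> 4 * h i * (\<epsilon> i * (u i \<bullet> x - b i))"
      using ee by (simp add: algebra_simps)
    then have "h i \<le> \<epsilon> i * (u i \<bullet> x - b i)"
      using h[OF i] by simp
    also have "\<dots> \<le> \<bar>\<epsilon> i * (u i \<bullet> x - b i)\<bar>"
      by simp
    also have "\<dots> = \<bar>u i \<bullet> x - b i\<bar>"
      by (simp add: abs_mult ee)
    finally show ?thesis .
  qed
  moreover have "norm (p \<epsilon>) \<le> M"
    using M[OF \<epsilon>] by (simp add: p_def)
  ultimately show ?thesis
    using nx by (intro exI[of _ x]) auto
qed

section \<open>Sheared normals\<close>

lemma unit_vector_coordinates:
  fixes s c :: real
  assumes "s\<^sup>2 + c\<^sup>2 = 1"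
  shows "\<bar>s\<bar> \<le> 1" "\<bar>c\<bar> \<le> 1"
proof -
  have "s\<^sup>2 \<le> 1" "c\<^sup>2 \<le> 1"
    using assms zero_le_power2[of s] zero_le_power2[of c] by linarith+
  then show "\<bar>s\<bar> \<le> 1" "\<bar>c\<bar> \<le> 1"
    by (simp_all add: abs_square_le_1)
qed

text \<open>
In the coordinates sheared by \<open>v\<close> a plank with half-width \<open>h\<close> and normal \<open>(s, c)\<close> gets the normal \<open>(s, c - v s)\<close> of squared
length \<open>g\<close>, and Bang's argument uses the weight \<open>t = h / g\<close>. The second estimate is the reason why the
method works: up to an error quadratic in \<open>s\<close>, the shear changes the vertical extent \<open>t (c - v s)\<close> of the plank by \<open>h v s\<close>.
\<close>
lemma sheared_normal:
  fixes s c v :: real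
  defines "g \<equiv> (c - v * s)\<^sup>2 + s\<^sup>2"
  assumes sc: "s\<^sup>2 + c\<^sup>2 = 1" and c: "0 \<le> c" and v: "\<bar>v\<bar> \<le> 1/750"
  shows "9/10 \<le> g"
    and "\<bar>(c - v * s) / g - (c + v * s)\<bar> \<le> 3 * \<bar>v\<bar> * s\<^sup>2"
    and "\<bar>1 / g - 1\<bar> \<le> 3 * \<bar>v\<bar> * \<bar>s\<bar>"
    and "1 - 2 * \<bar>v\<bar> * \<bar>s\<bar> \<le> g"
proof -
  have s1: "\<bar>s\<bar> \<le> 1" and c1: "c \<le> 1"
    using unit_vector_coordinates[OF sc] by auto
  have g: "g = 1 - v * s * (2 * c - v * s)"
    using sc unfolding g_def by (simp add: power2_eq_square algebra_simps)
  have vs: "\<bar>v * s\<bar> \<le> 1/750"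
    using mult_mono[OF v s1] by (simp add: abs_mult)
  have "\<bar>2 * c - v * s\<bar> \<le> 21/10"
    using vs c c1 by linarith
  then have d: "\<bar>v * s * (2 * c - v * s)\<bar> \<le> \<bar>v\<bar> * \<bar>s\<bar> * (21/10)"
    using mult_left_mono[of "\<bar>2 * c - v * s\<bar>" "21/10" "\<bar>v\<bar> * \<bar>s\<bar>"] by (simp add: abs_mult)
  have "\<bar>v\<bar> * \<bar>s\<bar> \<le> 1/750"
    using vs by (simp add: abs_mult)
  then show g9: "9/10 \<le> g"
    using d unfolding g by linarith
  have "1 / g - 1 = v * s * (2 * c - v * s) / g"
    using g g9 by (simp add: field_simps)
  also have "\<bar>\<dots>\<bar> = \<bar>v * s * (2 * c - v * s)\<bar> / g"
    using g9 by simp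
  also have "\<dots> \<le> (\<bar>v\<bar> * \<bar>s\<bar> * (21/10)) / (9/10)"
    using d g9 by (intro frac_le) auto
  also have "\<dots> \<le> 3 * \<bar>v\<bar> * \<bar>s\<bar>"
    by simp
  finally show "\<bar>1 / g - 1\<bar> \<le> 3 * \<bar>v\<bar> * \<bar>s\<bar>" .
  have "(c - v * s) - (c + v * s) * g = s\<^sup>2 * v * (v * c - 2 * s - v * (v * s)) + 2 * v * s * (s\<^sup>2 + c\<^sup>2 - 1)"
    unfolding g by (simp add: power2_eq_square algebra_simps)
  then have id: "(c - v * s) - (c + v * s) * g = s\<^sup>2 * v * (v * c - 2 * s - v * (v * s))"
    using sc by simp
  have "\<bar>v * c\<bar> \<le> 1/750"
    using mult_mono[OF v, of c 1] c c1 by (simp add: abs_mult)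
  moreover have "\<bar>v * (v * s)\<bar> \<le> 1/750"
    using mult_mono[OF v, of "\<bar>v * s\<bar>" 1] vs by (simp add: abs_mult)
  ultimately have k: "\<bar>v * c - 2 * s - v * (v * s)\<bar> \<le> 21/10"
    using s1 by linarith
  have "(c - v * s) / g - (c + v * s) = s\<^sup>2 * v * (v * c - 2 * s - v * (v * s)) / g"
    using id g9 by (simp add: field_simps)
  also have "\<bar>\<dots>\<bar> = s\<^sup>2 * \<bar>v\<bar> * \<bar>v * c - 2 * s - v * (v * s)\<bar> / g"
    using g9 by (simp add: abs_mult)
  also have "\<dots> \<le> (s\<^sup>2 * \<bar>v\<bar> * (21/10)) / (9/10)"
    using k g9 by (intro frac_le mult_left_mono) auto
  also have "\<dots> \<le> 3 * \<bar>v\<bar> * s\<^sup>2"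
    by (simp add: mult_ac)
  finally show "\<bar>(c - v * s) / g - (c + v * s)\<bar> \<le> 3 * \<bar>v\<bar> * s\<^sup>2" .
  have "v * s * (2 * c - v * s) = 2 * c * (v * s) - (v * s)\<^sup>2"
    by (simp add: power2_eq_square algebra_simps)
  also have "\<dots> \<le> 2 * c * \<bar>v * s\<bar>"
    using mult_left_mono[OF abs_ge_self[of "v * s"] c] zero_le_power2[of "v * s"] by linarith
  also have "\<dots> \<le> 2 * \<bar>v\<bar> * \<bar>s\<bar>"
    using c1 mult_right_mono[of c 1 "\<bar>v * s\<bar>"] by (simp add: abs_mult)
  finally show "1 - 2 * \<bar>v\<bar> * \<bar>s\<bar> \<le> g"
    unfolding g by linarith
qed

text \<open>
For the planks near the kink one weight has to serve for both slopes. The weight \<open>h / (1 - 2 \<rho> \<bar>s\<bar>)\<close>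
suffices for every slope up to \<open>\<rho>\<close>; it costs an error that is linear in \<open>s\<close>.
\<close>
lemma inflated_normal:
  fixes s c v \<rho> :: real
  assumes sc: "s\<^sup>2 + c\<^sup>2 = 1" and c: "0 \<le> c" and v: "\<bar>v\<bar> \<le> \<rho>" and \<rho>: "\<rho> \<le> 1/750"
  shows "0 < 1 - 2 * \<rho> * \<bar>s\<bar>"
    and "\<bar>(c - v * s) / (1 - 2 * \<rho> * \<bar>s\<bar>) - c\<bar> \<le> 4 * \<rho> * \<bar>s\<bar>"
    and "\<bar>1 / (1 - 2 * \<rho> * \<bar>s\<bar>) - 1\<bar> \<le> 3 * \<rho> * \<bar>s\<bar>"
    and "1 - 2 * \<rho> * \<bar>s\<bar> \<le> (c - v * s)\<^sup>2 + s\<^sup>2"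
proof -
  define k where "k = 1 - 2 * \<rho> * \<bar>s\<bar>"
  have s1: "\<bar>s\<bar> \<le> 1" and c1: "c \<le> 1"
    using unit_vector_coordinates[OF sc] by auto
  have \<rho>0: "0 \<le> \<rho>" using v by linarith
  have rs: "0 \<le> \<rho> * \<bar>s\<bar>" "\<rho> * \<bar>s\<bar> \<le> 1/750"
    using mult_mono[OF \<rho> s1] \<rho>0 by auto
  have k: "9/10 \<le> k" "k \<le> 1"
    using rs unfolding k_def by linarith+
  then show "0 < 1 - 2 * \<rho> * \<bar>s\<bar>" unfolding k_def by linarith
  have "1 / k - 1 = 2 * (\<rho> * \<bar>s\<bar>) / k"
    using k by (simp add: k_def field_simps)
  moreover have "\<dots> \<le> 2 * (\<rho> * \<bar>s\<bar>) / (9/10)"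
    using k rs by (intro frac_le) auto
  moreover have "0 \<le> 2 * (\<rho> * \<bar>s\<bar>) / k"
    using k rs by simp
  ultimately show "\<bar>1 / (1 - 2 * \<rho> * \<bar>s\<bar>) - 1\<bar> \<le> 3 * \<rho> * \<bar>s\<bar>"
    using rs unfolding k_def[symmetric] by (simp add: abs_le_iff)
  have "(c - v * s) / k - c = (2 * c * (\<rho> * \<bar>s\<bar>) - v * s) / k"
    using k by (simp add: k_def field_simps)
  also have "\<bar>\<dots>\<bar> = \<bar>2 * c * (\<rho> * \<bar>s\<bar>) - v * s\<bar> / k"
    using k by simp
  also have "\<dots> \<le> (3 * (\<rho> * \<bar>s\<bar>)) / (9/10)"
  proof (intro frac_le)
    have "\<bar>v * s\<bar> \<le> \<rho> * \<bar>s\<bar>"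
      using v by (simp add: abs_mult mult_right_mono)
    moreover have "0 \<le> c * (\<rho> * \<bar>s\<bar>)" "c * (\<rho> * \<bar>s\<bar>) \<le> \<rho> * \<bar>s\<bar>"
      using c c1 rs mult_right_mono[of c 1 "\<rho> * \<bar>s\<bar>"] by auto
    ultimately show "\<bar>2 * c * (\<rho> * \<bar>s\<bar>) - v * s\<bar> \<le> 3 * (\<rho> * \<bar>s\<bar>)"
      by linarith
  qed (use k rs in auto)
  also have "\<dots> \<le> 4 * \<rho> * \<bar>s\<bar>"
    using rs by simp
  finally show "\<bar>(c - v * s) / (1 - 2 * \<rho> * \<bar>s\<bar>) - c\<bar> \<le> 4 * \<rho> * \<bar>s\<bar>"
    unfolding k_def .
  have "1 - 2 * \<bar>v\<bar> * \<bar>s\<bar> \<le> (c - v * s)\<^sup>2 + s\<^sup>2"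
    using sheared_normal(4)[OF sc c] v \<rho> by auto
  moreover have "2 * \<bar>v\<bar> * \<bar>s\<bar> \<le> 2 * \<rho> * \<bar>s\<bar>"
    using v by (simp add: mult_right_mono)
  ultimately show "1 - 2 * \<rho> * \<bar>s\<bar> \<le> (c - v * s)\<^sup>2 + s\<^sup>2"
    by linarith
qed

section \<open>Where the missed point lands\<close>

lemma weighted_cauchy_schwarz:
  fixes h s :: "'i \<Rightarrow> real"
  assumes "\<And>i. i \<in> A \<Longrightarrow> 0 \<le> h i"
  shows "(\<Sum>i\<in>A. h i * \<bar>s i\<bar>)\<^sup>2 \<le> (\<Sum>i\<in>A. h i) * (\<Sum>i\<in>A. h i * (s i)\<^sup>2)"
proof -
  have "(\<Sum>i\<in>A. h i * \<bar>s i\<bar>) = (\<Sum>i\<in>A. sqrt (h i) * (sqrt (h i) * \<bar>s i\<bar>))"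
    using assms by (intro sum.cong) (auto simp flip: mult.assoc)
  then have "(\<Sum>i\<in>A. h i * \<bar>s i\<bar>)\<^sup>2 \<le> (\<Sum>i\<in>A. (sqrt (h i))\<^sup>2) * (\<Sum>i\<in>A. (sqrt (h i) * \<bar>s i\<bar>)\<^sup>2)"
    by (metis Cauchy_Schwarz_ineq_sum)
  also have "(\<Sum>i\<in>A. (sqrt (h i))\<^sup>2) = (\<Sum>i\<in>A. h i)"
    using assms by (intro sum.cong) auto
  also have "(\<Sum>i\<in>A. (sqrt (h i) * \<bar>s i\<bar>)\<^sup>2) = (\<Sum>i\<in>A. h i * (s i)\<^sup>2)"
    using assms by (intro sum.cong) (auto simp: power_mult_distrib)
  finally show ?thesis .
qed

text \<open>
The defect on the right controls the tilts because \<open>s\<^sup>2 = (1 - c) (1 + c) \<le> 2 (1 - c)\<close>.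
\<close>
lemma sum_tilt_sq_le:
  fixes h s c :: "'i \<Rightarrow> real"
  assumes "finite I" "A \<subseteq> I" "\<And>i. i \<in> I \<Longrightarrow> 0 \<le> h i" "\<And>i. i \<in> I \<Longrightarrow> (s i)\<^sup>2 + (c i)\<^sup>2 = 1"
    and "\<And>i. i \<in> I \<Longrightarrow> 0 \<le> c i" "sum h I \<le> 1"
  shows "(\<Sum>i\<in>A. h i * (s i)\<^sup>2) \<le> 2 * (1 - (\<Sum>i\<in>I. h i * c i))"
proof -
  have "(\<Sum>i\<in>A. h i * (s i)\<^sup>2) \<le> (\<Sum>i\<in>I. h i * (s i)\<^sup>2)"
    using assms by (intro sum_mono2) auto
  also have "\<dots> \<le> (\<Sum>i\<in>I. 2 * h i - 2 * (h i * c i))"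
  proof (intro sum_mono)
    fix i assume i: "i \<in> I"
    have "(s i)\<^sup>2 = (1 - c i) * (1 + c i)"
      using assms(4)[OF i] by (simp add: power2_eq_square algebra_simps)
    also have "\<dots> \<le> (1 - c i) * 2"
      using unit_vector_coordinates(2)[OF assms(4)[OF i]] by (intro mult_left_mono) auto
    finally have "h i * (s i)\<^sup>2 \<le> h i * ((1 - c i) * 2)"
      using assms(3)[OF i] by (intro mult_left_mono)
    then show "h i * (s i)\<^sup>2 \<le> 2 * h i - 2 * (h i * c i)"
      by (simp add: algebra_simps)
  qed
  also have "\<dots> = 2 * sum h I - 2 * (\<Sum>i\<in>I. h i * c i)"
    by (simp add: sum_subtractf sum_distrib_left)
  also have "\<dots> \<le> 2 * (1 - (\<Sum>i\<in>I. h i * c i))"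
    using assms(6) by (simp add: right_diff_distrib)
  finally show ?thesis .
qed

text \<open>
The position \<open>(P, y)\<close>, in sheared coordinates, of the point that belongs to arbitrary signs. Here \<open>K\<close> are the
planks near the kink, \<open>a\<^sub>i\<close> is the vertical extent and \<open>t\<^sub>i\<close> the weight of the \<open>i\<close>-th plank. If all signs are
1, then \<open>y\<close> stays below 1 by a fixed part of \<open>D\<close>: the defect \<open>D\<close> outweighs the first order term, which
is small by hypothesis, and the second order terms. In general, let \<open>\<omega> = 1 - y\<close> be the depth below the pole. The
planks with sign -1 have total half-width at most \<open>3 \<omega>\<close>, and by Cauchy-Schwarz they move \<open>P\<close> away
from 0 by \<open>O(sqrt (\<omega> D))\<close>, which is far less than the half chord of the disk at depth \<open>\<omega>\<close>, about \<open>sqrt (2 \<omega>)\<close>.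
\<close>
lemma landing_point_bounds:
  fixes h s c v a t :: "'i \<Rightarrow> real" and D \<rho> \<beta> :: real and I K :: "'i set"
  assumes I: "finite I" and K: "K \<subseteq> I" and \<epsilon>: "\<And>i. i \<in> I \<Longrightarrow> \<epsilon> i = -1 \<or> \<epsilon> i = 1"
    and h: "\<And>i. i \<in> I \<Longrightarrow> 0 < h i" and sc: "\<And>i. i \<in> I \<Longrightarrow> (s i)\<^sup>2 + (c i)\<^sup>2 = 1"
    and c: "\<And>i. i \<in> I \<Longrightarrow> 0 \<le> c i"
    and hs: "(\<Sum>i\<in>I. h i * s i) = 0" and S: "sum h I \<le> 1"
    and D: "D = 1 - (\<Sum>i\<in>I. h i * c i)" "0 < D" "D \<le> 1/10^7"
    and \<rho>: "\<rho> = 1/750" and \<beta>: "0 \<le> \<beta>" "\<beta> \<le> D/20"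
    and KD: "(\<Sum>i\<in>K. h i * \<bar>s i\<bar>) \<le> 28 * D"
    and aU: "\<And>i. i \<in> I - K \<Longrightarrow> \<bar>v i\<bar> \<le> \<rho> \<and> \<bar>a i - h i * (c i + v i * s i)\<bar> \<le> 3 * \<rho> * (h i * (s i)\<^sup>2)"
    and aK: "\<And>i. i \<in> K \<Longrightarrow> \<bar>a i - h i * c i\<bar> \<le> 4 * \<rho> * (h i * \<bar>s i\<bar>)"
    and t: "\<And>i. i \<in> I \<Longrightarrow> \<bar>t i - h i\<bar> \<le> 3 * \<rho> * (h i * \<bar>s i\<bar>)"
    and FO: "(\<Sum>i\<in>I - K. h i * (v i * s i)) \<le> 28 * \<rho> * D"
  defines "y \<equiv> (\<Sum>i\<in>I. \<epsilon> i * a i) + \<beta>" and "P \<equiv> (\<Sum>i\<in>I. \<epsilon> i * (t i * s i))"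
  shows "D/2 \<le> 1 - y" "P\<^sup>2 \<le> (1 - y) / 4" "P\<^sup>2 \<le> 9/4 * D"
proof -
  define A where "A = {i \<in> I. \<epsilon> i = -1}"
  have A: "A \<subseteq> I" "finite A"
    using I by (auto simp: A_def)
  have minus: "(\<Sum>i\<in>I. \<epsilon> i * f i) = sum f I - 2 * sum f A" for f
  proof -
    have "(\<Sum>i\<in>I. \<epsilon> i * f i) = (\<Sum>i\<in>I. f i - 2 * (if i \<in> A then f i else 0))"
      using \<epsilon> by (intro sum.cong) (force simp: A_def)+
    also have "\<dots> = sum f I - 2 * (\<Sum>i\<in>I. if i \<in> A then f i else 0)"
      by (simp add: sum_subtractf sum_distrib_left)
    also have "(\<Sum>i\<in>I. if i \<in> A then f i else 0) = sum f A"
      using I A by (simp add: sum.If_cases Int_absorb1)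
    finally show ?thesis .
  qed
  have \<Theta>: "(\<Sum>i\<in>B. h i * (s i)\<^sup>2) \<le> 2 * D" if "B \<subseteq> I" for B
    using sum_tilt_sq_le[OF I that _ sc c S] h D(1) by (simp add: less_imp_le)
  have s1: "\<bar>s i\<bar> \<le> 1" and c1: "c i \<le> 1" if "i \<in> I" for i
    using unit_vector_coordinates[OF sc[OF that]] by auto
  have ss: "(s i)\<^sup>2 \<le> \<bar>s i\<bar>" if "i \<in> I" for i
    using s1[OF that] mult_left_mono[of "\<bar>s i\<bar>" 1 "\<bar>s i\<bar>"] by (simp add: power2_eq_square flip: abs_mult)
  have hs0: "0 \<le> h i * \<bar>s i\<bar>" "0 \<le> h i * (s i)\<^sup>2" "h i * (s i)\<^sup>2 \<le> h i * \<bar>s i\<bar>" if "i \<in> I" for i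
    using h[OF that] ss[OF that] by (auto simp: mult_left_mono)

  \<comment> \<open>useful unless the plank is almost vertical, when the bound may be slightly negative\<close>
  have lower: "h i * (c i - 4 * \<rho> * \<bar>s i\<bar>) \<le> a i" if i: "i \<in> I" for i
  proof (cases "i \<in> K")
    case True
    then show ?thesis using aK[OF True] by (simp add: abs_le_iff algebra_simps)
  next
    case False
    then have iK: "i \<in> I - K" using i by blast
    have "- (\<rho> * \<bar>s i\<bar>) \<le> v i * s i"
      using aU[OF iK] mult_right_mono[of "\<bar>v i\<bar>" \<rho> "\<bar>s i\<bar>"] by (simp add: abs_mult[symmetric] abs_le_iff)
    then have "h i * (- (\<rho> * \<bar>s i\<bar>)) \<le> h i * (v i * s i)"
      using h[OF i] by (intro mult_left_mono) auto
    moreover have "3 * \<rho> * (h i * (s i)\<^sup>2) \<le> 3 * \<rho> * (h i * \<bar>s i\<bar>)"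
      by (rule mult_left_mono[OF hs0(3)[OF i]]) (simp add: \<rho>)
    ultimately show ?thesis
      using aU[OF iK] by (simp add: abs_le_iff algebra_simps)
  qed

  have "sum a I = sum a (I - K) + sum a K"
    using I K by (simp add: sum.subset_diff)
  also have "sum a (I - K) \<le> (\<Sum>i\<in>I - K. h i * c i + h i * (v i * s i) + 3 * \<rho> * (h i * (s i)\<^sup>2))"
    using aU by (intro sum_mono) (simp add: abs_le_iff algebra_simps)
  also have "\<dots> = (\<Sum>i\<in>I - K. h i * c i) + (\<Sum>i\<in>I - K. h i * (v i * s i)) + 3 * \<rho> * (\<Sum>i\<in>I - K. h i * (s i)\<^sup>2)"
    by (simp add: sum.distrib sum_distrib_left)
  also have "sum a K \<le> (\<Sum>i\<in>K. h i * c i + 4 * \<rho> * (h i * \<bar>s i\<bar>))"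
    using aK by (intro sum_mono) (simp add: abs_le_iff algebra_simps)
  also have "\<dots> = (\<Sum>i\<in>K. h i * c i) + 4 * \<rho> * (\<Sum>i\<in>K. h i * \<bar>s i\<bar>)"
    by (simp add: sum.distrib sum_distrib_left)
  finally have "sum a I \<le> ((\<Sum>i\<in>I - K. h i * c i) + (\<Sum>i\<in>K. h i * c i)) + (\<Sum>i\<in>I - K. h i * (v i * s i))
      + 3 * \<rho> * (\<Sum>i\<in>I - K. h i * (s i)\<^sup>2) + 4 * \<rho> * (\<Sum>i\<in>K. h i * \<bar>s i\<bar>)"
    by linarith
  also have "(\<Sum>i\<in>I - K. h i * c i) + (\<Sum>i\<in>K. h i * c i) = 1 - D"
    using I K D(1) by (simp add: sum.subset_diff)
  finally have top: "sum a I \<le> 1 - D + 146 * \<rho> * D"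
    using FO \<Theta>[of "I - K"] KD D(2) by (simp add: \<rho>)

  \<comment> \<open>two lower bounds for the total extent of the flipped planks: the first controls their total half-width, the second is
    needed when that is small and only says that almost vertical planks do no harm\<close>
  define \<eta> where "\<eta> = sum h A"
  have "(\<Sum>i\<in>A. (1 - 4 * \<rho>) * h i - h i * (s i)\<^sup>2) \<le> sum a A"
  proof (intro sum_mono)
    fix i assume "i \<in> A"
    then have i: "i \<in> I" using A by blast
    have "(c i)\<^sup>2 \<le> c i"
      using c[OF i] c1[OF i] mult_left_mono[of "c i" 1 "c i"] by (simp add: power2_eq_square)
    then have "1 - (s i)\<^sup>2 \<le> c i"
      using sc[OF i] by linarith
    moreover have "4 * \<rho> * \<bar>s i\<bar> \<le> 4 * \<rho>"
      using s1[OF i] \<rho> by simp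
    ultimately have "h i * (1 - (s i)\<^sup>2 - 4 * \<rho>) \<le> h i * (c i - 4 * \<rho> * \<bar>s i\<bar>)"
      using h[OF i] by (intro mult_left_mono) auto
    then show "(1 - 4 * \<rho>) * h i - h i * (s i)\<^sup>2 \<le> a i"
      using lower[OF i] by (simp add: algebra_simps)
  qed
  then have "(1 - 4 * \<rho>) * \<eta> - (\<Sum>i\<in>A. h i * (s i)\<^sup>2) \<le> sum a A"
    by (simp add: sum_subtractf \<eta>_def flip: sum_distrib_left)
  then have A1: "(1 - 4 * \<rho>) * \<eta> - 2 * D \<le> sum a A"
    using \<Theta>[OF A(1)] by linarith
  have "(\<Sum>i\<in>A. - (8 * \<rho>) * (h i * (s i)\<^sup>2)) \<le> sum a A"
  proof (intro sum_mono)
    fix i assume "i \<in> A"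
    then have i: "i \<in> I" using A by blast
    have "- (8 * \<rho>) * (s i)\<^sup>2 \<le> c i - 4 * \<rho> * \<bar>s i\<bar>"
    proof (cases "\<bar>s i\<bar> \<le> 1/2")
      case True
      then have "(s i)\<^sup>2 \<le> 1/4"
        using power_mono[of "\<bar>s i\<bar>" "1/2" 2] by (simp add: power2_eq_square)
      then have "1/4 \<le> (c i)\<^sup>2"
        using sc[OF i] by simp
      then have "1/2 \<le> c i"
        using c[OF i] power2_le_imp_le[of "1/2" "c i"] by (simp add: power2_eq_square)
      moreover have "4 * \<rho> * \<bar>s i\<bar> \<le> 4 * \<rho>" "- (8 * \<rho>) * (s i)\<^sup>2 \<le> 0"
        using s1[OF i] \<rho> by auto
      ultimately show ?thesis using \<rho> by linarith
    next
      case False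
      then have "\<bar>s i\<bar> \<le> 2 * (s i)\<^sup>2"
        using mult_right_mono[of "1/2" "\<bar>s i\<bar>" "\<bar>s i\<bar>"] by (simp add: power2_eq_square flip: abs_mult)
      then have "4 * \<rho> * \<bar>s i\<bar> \<le> 4 * \<rho> * (2 * (s i)\<^sup>2)"
        using \<rho> by (intro mult_left_mono) auto
      then show ?thesis using c[OF i] by linarith
    qed
    then have "h i * (- (8 * \<rho>) * (s i)\<^sup>2) \<le> h i * (c i - 4 * \<rho> * \<bar>s i\<bar>)"
      using h[OF i] by (intro mult_left_mono) auto
    then show "- (8 * \<rho>) * (h i * (s i)\<^sup>2) \<le> a i"
      using lower[OF i] by (simp add: algebra_simps)
  qed
  then have "- (8 * \<rho>) * (\<Sum>i\<in>A. h i * (s i)\<^sup>2) \<le> sum a A"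
    by (simp only: sum_distrib_left)
  then have A2: "- (16 * \<rho>) * D \<le> sum a A"
    using \<Theta>[OF A(1)] by (simp add: \<rho>)

  define \<omega> where "\<omega> = 1 - y"
  have "\<omega> = 1 - sum a I + 2 * sum a A - \<beta>"
    unfolding \<omega>_def y_def minus by simp
  then have w: "3/4 * D + 2 * sum a A \<le> \<omega>"
    using top \<beta> D(2) by (simp add: \<rho>)
  then have w1: "7/10 * D \<le> \<omega>"
    using A2 D(2) by (simp add: \<rho>)
  then show "D/2 \<le> 1 - y"
    using D(2) unfolding \<omega>_def by linarith
  have eta: "\<eta> \<le> 3 * \<omega>"
    using w A1 w1 D(2) by (simp add: \<rho>)
  have eta0: "0 \<le> \<eta>"
    unfolding \<eta>_def using h A by (intro sum_nonneg) (auto simp: less_imp_le)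

  have tle: "\<bar>t i * s i\<bar> \<le> 101/100 * (h i * \<bar>s i\<bar>)" if i: "i \<in> I" for i
  proof -
    have "3 * \<rho> * (h i * \<bar>s i\<bar>) \<le> 1/100 * h i"
      using mult_left_mono[OF s1[OF i], of "h i"] h[OF i] by (simp add: \<rho>)
    then have "\<bar>t i\<bar> \<le> 101/100 * h i"
      using t[OF i] h[OF i] by linarith
    then show ?thesis
      using mult_right_mono[of "\<bar>t i\<bar>" "101/100 * h i" "\<bar>s i\<bar>"] by (simp add: abs_mult)
  qed
  have cs: "(\<Sum>i\<in>B. h i * \<bar>s i\<bar>)\<^sup>2 \<le> sum h B * (2 * D)" if B: "B \<subseteq> I" for B
  proof -
    have "(\<Sum>i\<in>B. h i * \<bar>s i\<bar>)\<^sup>2 \<le> sum h B * (\<Sum>i\<in>B. h i * (s i)\<^sup>2)"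
      using h B by (intro weighted_cauchy_schwarz) (auto simp: less_imp_le subset_iff)
    also have "\<dots> \<le> sum h B * (2 * D)"
      using \<Theta>[OF B] h B by (intro mult_left_mono sum_nonneg) (auto simp: less_imp_le subset_iff)
    finally show ?thesis .
  qed

  \<comment> \<open>the crude bound \<open>P = O(sqrt D)\<close>\<close>
  have "\<bar>P\<bar> \<le> (\<Sum>i\<in>I. \<bar>\<epsilon> i * (t i * s i)\<bar>)"
    unfolding P_def by (rule sum_abs)
  also have "\<dots> \<le> (\<Sum>i\<in>I. 101/100 * (h i * \<bar>s i\<bar>))"
    using tle \<epsilon> by (intro sum_mono) (force simp: abs_mult)
  finally have "\<bar>P\<bar> \<le> 101/100 * (\<Sum>i\<in>I. h i * \<bar>s i\<bar>)"
    by (simp only: sum_distrib_left)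
  then have "\<bar>P\<bar>\<^sup>2 \<le> (101/100 * (\<Sum>i\<in>I. h i * \<bar>s i\<bar>))\<^sup>2"
    by (intro power_mono) auto
  also have "\<dots> = (101/100)\<^sup>2 * (\<Sum>i\<in>I. h i * \<bar>s i\<bar>)\<^sup>2"
    by (simp only: power_mult_distrib)
  also have "\<dots> \<le> (101/100)\<^sup>2 * (1 * (2 * D))"
    using order_trans[OF cs[OF order_refl] mult_right_mono[OF S, of "2 * D"]] D(2)
    by (intro mult_left_mono) auto
  also have "\<dots> \<le> 9/4 * D"
    using D(2) by (simp add: power2_eq_square)
  finally show "P\<^sup>2 \<le> 9/4 * D" by simp

  \<comment> \<open>the bound near the pole: \<open>\<Sum> h\<^sub>i s\<^sub>i = 0\<close> makes the contribution of the signs 1 quadratic in the tilts\<close>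
  have "(\<Sum>i\<in>I. t i * s i) = (\<Sum>i\<in>I. (t i - h i) * s i)"
    using hs by (simp add: left_diff_distrib sum_subtractf)
  also have "\<bar>\<dots>\<bar> \<le> (\<Sum>i\<in>I. \<bar>(t i - h i) * s i\<bar>)"
    by (rule sum_abs)
  also have "\<dots> \<le> (\<Sum>i\<in>I. 3 * \<rho> * (h i * (s i)\<^sup>2))"
  proof (intro sum_mono)
    fix i assume i: "i \<in> I"
    show "\<bar>(t i - h i) * s i\<bar> \<le> 3 * \<rho> * (h i * (s i)\<^sup>2)"
      using mult_right_mono[OF t[OF i], of "\<bar>s i\<bar>"]
      by (simp add: abs_mult power2_eq_square mult_ac)
  qed
  also have "\<dots> \<le> 1/100 * D"
    unfolding sum_distrib_left[symmetric] using \<Theta>[of I] D(2) by (simp add: \<rho>)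
  finally have P1: "\<bar>\<Sum>i\<in>I. t i * s i\<bar> \<le> 1/100 * D" .
  have "\<bar>\<Sum>i\<in>A. t i * s i\<bar> \<le> (\<Sum>i\<in>A. \<bar>t i * s i\<bar>)"
    by (rule sum_abs)
  also have "\<dots> \<le> (\<Sum>i\<in>A. 101/100 * (h i * \<bar>s i\<bar>))"
    using tle A by (intro sum_mono) auto
  finally have P2: "\<bar>\<Sum>i\<in>A. t i * s i\<bar> \<le> 101/100 * (\<Sum>i\<in>A. h i * \<bar>s i\<bar>)"
    by (simp only: sum_distrib_left)
  define Q where "Q = (\<Sum>i\<in>A. h i * \<bar>s i\<bar>)"
  have Q: "Q\<^sup>2 \<le> 6 * \<omega> * D"
    using cs[OF A(1)] mult_right_mono[OF eta, of "2 * D"] D(2) unfolding Q_def \<eta>_def by linarith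
  have "\<bar>P\<bar> \<le> 1/100 * D + 3 * Q"
    unfolding P_def minus using P1 P2 Q_def sum_nonneg[of A "\<lambda>i. h i * \<bar>s i\<bar>"] hs0 A
    by (auto simp: abs_le_iff subset_iff)
  then have "\<bar>P\<bar>\<^sup>2 \<le> (1/100 * D + 3 * Q)\<^sup>2"
    by (intro power_mono) auto
  also have "\<dots> \<le> 2 * (1/100 * D)\<^sup>2 + 2 * (3 * Q)\<^sup>2"
    using zero_le_power2[of "1/100 * D - 3 * Q"] by (simp add: power2_eq_square algebra_simps)
  also have "\<dots> \<le> D * \<omega> + 108 * \<omega> * D"
  proof -
    have "2 * (1/100 * D)\<^sup>2 \<le> D * (7/10 * D)"
      by (simp add: power2_eq_square)
    also have "\<dots> \<le> D * \<omega>"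
      using w1 D(2) by (intro mult_left_mono) auto
    moreover have "2 * (3 * Q)\<^sup>2 \<le> 108 * \<omega> * D"
      using Q by (simp add: power_mult_distrib mult_ac)
    ultimately show ?thesis by linarith
  qed
  also have "\<dots> = 109 * D * \<omega>" by simp
  also have "\<dots> \<le> 1/4 * \<omega>"
    using D w1 by (intro mult_right_mono) auto
  finally show "P\<^sup>2 \<le> (1 - y) / 4"
    by (simp add: \<omega>_def)
qed

section \<open>The broken line around the hole\<close>

lemma abs_mult_pos_le: "0 < h \<Longrightarrow> \<bar>x\<bar> \<le> k \<Longrightarrow> \<bar>h * x\<bar> \<le> h * k" for h x k :: real
  by (simp add: abs_mult)

text \<open>
The kink is the point \<open>(R, \<kappa>)\<close>, and \<open>Rp\<close>, \<open>Rm\<close> are the horizontal distances that the segments from it to the upper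
and the lower pole cover per unit of height, at most \<open>\<rho> = 4 R / 3\<close>. At abscissas between 0 and \<open>R\<close>, the planks of \<open>L\<close> stay
below the height \<open>\<kappa>\<close> and those of \<open>U\<close> above it, by a margin of order \<open>sqrt D\<close>; the others form \<open>K\<close>. Suppose that the functional for the
upper segment produces a point with height \<open>y \<ge> \<kappa>\<close>. Then the actual point \<open>(Rp (1 - y) + P, y)\<close> lies in the
disk and outside the hole. For the planks of \<open>U\<close> and \<open>K\<close>, Bang's inequality speaks about exactly this point, since the
offset \<open>b - \<bar>v\<bar> s\<close> takes the position of the segment into account. The planks of \<open>L\<close> simply lie below it.
\<close>
lemma missed_point_above_kink:
  fixes h s c b t v \<xi> \<epsilon> :: "'i \<Rightarrow> real" and D \<kappa> R \<rho> \<beta> Rp Rm y P :: real and I K L U :: "'i set"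
  assumes R_def: "R = 1/1000" and \<rho>_def: "\<rho> = 1/750"
  assumes \<xi>_def: "\<xi> = (\<lambda>i. R * \<bar>s i\<bar> + 3 * sqrt D)"
  assumes L_def: "L = {i \<in> I. b i < c i * \<kappa> - \<xi> i}" and U_def: "U = {i \<in> I. c i * \<kappa> + \<xi> i < b i}"
  assumes K_def: "K = I - (L \<union> U)"
  assumes Rp_def: "Rp = R / (1 - \<kappa>)" and Rm_def: "Rm = R / (1 + \<kappa>)"
  assumes v_def: "v = (\<lambda>i. if i \<in> L then - Rm else Rp)"
  assumes tK: "\<And>i. i \<in> K \<Longrightarrow> t i = h i / (1 - 2 * \<rho> * \<bar>s i\<bar>)"
    and tLU: "\<And>i. i \<in> I - K \<Longrightarrow> t i = h i / ((c i - v i * s i)\<^sup>2 + (s i)\<^sup>2)"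
  assumes I: "finite I" and \<epsilon>: "\<And>i. i \<in> I \<Longrightarrow> \<epsilon> i = -1 \<or> \<epsilon> i = 1"
    and h: "\<And>i. i \<in> I \<Longrightarrow> 0 < h i" "\<And>i. i \<in> I \<Longrightarrow> (h i)\<^sup>2 \<le> D"
    and sc: "\<And>i. i \<in> I \<Longrightarrow> (s i)\<^sup>2 + (c i)\<^sup>2 = 1"
    and c: "\<And>i. i \<in> I \<Longrightarrow> 0 \<le> c i"
    and hs: "(\<Sum>i\<in>I. h i * s i) = 0" and S: "sum h I \<le> 1"
    and D: "D = 1 - (\<Sum>i\<in>I. h i * c i)" "0 < D" "D \<le> 1/10^7"
    and \<beta>: "0 \<le> \<beta>" "\<beta> \<le> D/20" and \<kappa>: "\<bar>\<kappa>\<bar> \<le> 1/4"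
    and KD: "(\<Sum>i\<in>K. h i * \<bar>s i\<bar>) \<le> 28 * D"
    and FO: "(\<Sum>i\<in>I - K. h i * (v i * s i)) \<le> 28 * \<rho> * D"
  assumes y_def: "y = (\<Sum>i\<in>I. \<epsilon> i * (t i * (c i - v i * s i))) + \<beta>" and P_def: "P = (\<Sum>i\<in>I. \<epsilon> i * (t i * s i))"
  assumes y: "\<kappa> \<le> y"
    and margin: "\<And>i. i \<in> I \<Longrightarrow> t i * ((c i - v i * s i)\<^sup>2 + (s i)\<^sup>2)
                   \<le> \<epsilon> i * ((c i - v i * s i) * y + s i * P - (b i - \<bar>v i\<bar> * s i))"
  shows "\<exists>x1 x2. x1\<^sup>2 + x2\<^sup>2 \<le> 1 \<and> 1/10^7 \<le> sqrt (x1\<^sup>2 + x2\<^sup>2) \<and> (\<forall>i\<in>I. h i \<le> \<bar>s i * x1 + c i * x2 - b i\<bar>)"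
proof -
  have Rp: "0 < Rp" "Rp \<le> \<rho>" "8/10 * R \<le> Rp" and Rm: "0 < Rm" "Rm \<le> \<rho>"
    using \<kappa> by (auto simp: Rp_def Rm_def R_def \<rho>_def field_simps abs_le_iff)
  have vle: "\<bar>v i\<bar> \<le> \<rho>" for i
    using Rp Rm by (simp add: v_def)
  have vle': "\<bar>v i\<bar> \<le> 1/750" for i
    using vle[of i] by (simp add: \<rho>_def)
  have KI: "K \<subseteq> I" by (auto simp: K_def)
  have \<rho>0: "\<rho> = 1/750" by (simp add: \<rho>_def)
  have aU: "\<bar>v i\<bar> \<le> \<rho> \<and> \<bar>t i * (c i - v i * s i) - h i * (c i + v i * s i)\<bar> \<le> 3 * \<rho> * (h i * (s i)\<^sup>2)"
    if "i \<in> I - K" for i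
  proof -
    have i: "i \<in> I" using that by blast
    have "t i * (c i - v i * s i) - h i * (c i + v i * s i)
       = h i * ((c i - v i * s i) / ((c i - v i * s i)\<^sup>2 + (s i)\<^sup>2) - (c i + v i * s i))"
      using that by (simp add: tK tLU right_diff_distrib diff_divide_distrib)
    also have "\<bar>\<dots>\<bar> \<le> h i * (3 * \<bar>v i\<bar> * (s i)\<^sup>2)"
      by (rule abs_mult_pos_le[OF h(1)[OF i] sheared_normal(2)[OF sc[OF i] c[OF i] vle']])
    also have "\<dots> \<le> h i * (3 * \<rho> * (s i)\<^sup>2)"
      using vle[of i] h(1)[OF i] by (intro mult_left_mono mult_right_mono) auto
    finally show ?thesis using vle[of i] by (simp add: mult_ac)
  qed
  have aK: "\<bar>t i * (c i - v i * s i) - h i * c i\<bar> \<le> 4 * \<rho> * (h i * \<bar>s i\<bar>)" if "i \<in> K" for i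
  proof -
    have i: "i \<in> I" using that KI by blast
    have "t i * (c i - v i * s i) - h i * c i = h i * ((c i - v i * s i) / (1 - 2 * \<rho> * \<bar>s i\<bar>) - c i)"
      using that by (simp add: tK tLU right_diff_distrib diff_divide_distrib)
    also have "\<bar>\<dots>\<bar> \<le> h i * (4 * \<rho> * \<bar>s i\<bar>)"
      by (rule abs_mult_pos_le[OF h(1)[OF i] inflated_normal(2)[OF sc[OF i] c[OF i] vle]]) (simp add: \<rho>0)
    finally show ?thesis by (simp add: mult_ac)
  qed
  have tt: "\<bar>t i - h i\<bar> \<le> 3 * \<rho> * (h i * \<bar>s i\<bar>)" if i: "i \<in> I" for i
  proof (cases "i \<in> K")
    case True
    then have "t i - h i = h i * (1 / (1 - 2 * \<rho> * \<bar>s i\<bar>) - 1)"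
      by (simp add: tK tLU right_diff_distrib diff_divide_distrib)
    also have "\<bar>\<dots>\<bar> \<le> h i * (3 * \<rho> * \<bar>s i\<bar>)"
      by (rule abs_mult_pos_le[OF h(1)[OF i] inflated_normal(3)[OF sc[OF i] c[OF i] vle]]) (simp add: \<rho>0)
    finally show ?thesis by (simp add: mult_ac)
  next
    case False
    with i have "t i - h i = h i * (1 / ((c i - v i * s i)\<^sup>2 + (s i)\<^sup>2) - 1)"
      by (simp add: tK tLU right_diff_distrib diff_divide_distrib)
    also have "\<bar>\<dots>\<bar> \<le> h i * (3 * \<bar>v i\<bar> * \<bar>s i\<bar>)"
      by (rule abs_mult_pos_le[OF h(1)[OF i] sheared_normal(3)[OF sc[OF i] c[OF i] vle']])
    also have "\<dots> \<le> h i * (3 * \<rho> * \<bar>s i\<bar>)"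
      using vle[of i] h(1)[OF i] by (intro mult_left_mono mult_right_mono) auto
    finally show ?thesis by (simp add: mult_ac)
  qed
  note land = landing_point_bounds[where \<epsilon> = \<epsilon>, OF I KI \<epsilon> h(1) sc c hs S D \<rho>0 \<beta> KD aU aK tt FO, folded y_def P_def]
  define \<omega> where "\<omega> = 1 - y"
  have w: "D/2 \<le> \<omega>" "P\<^sup>2 \<le> \<omega> / 4" "P\<^sup>2 \<le> 9/4 * D" "\<omega> \<le> 5/4"
    using land y \<kappa> by (auto simp: \<omega>_def)
  define E where "E = sqrt D"
  have E: "0 < E" "E\<^sup>2 = D" using D(2) by (auto simp: E_def)
  have "E\<^sup>2 \<le> (4/10^4)\<^sup>2" using E D(3) by (simp add: power2_eq_square)
  then have E4: "E \<le> 4/10^4" by (rule power2_le_imp_le) simp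
  have "\<bar>P\<bar>\<^sup>2 \<le> (3/2 * E)\<^sup>2" using w(3) E by (simp add: power_mult_distrib power2_eq_square)
  then have PE: "\<bar>P\<bar> \<le> 3/2 * E" by (rule power2_le_imp_le) (use E in simp)
  \<comment> \<open>the broken line is at \<open>Rp * \<omega>\<close> for the height \<open>y\<close>, and \<open>P\<close> is the lateral deviation from it\<close>
  define x1 where "x1 = Rp * \<omega> + P"
  have "x1\<^sup>2 \<le> 2 * (Rp * \<omega>)\<^sup>2 + 2 * P\<^sup>2"
    using zero_le_power2[of "Rp * \<omega> - P"] by (simp add: x1_def power2_eq_square algebra_simps)
  also have "\<dots> \<le> 1/10 * \<omega> + 1/2 * \<omega>"
  proof -
    have "Rp * \<omega> \<le> 1/10" "0 \<le> Rp * \<omega>" "Rp * \<omega> \<le> 1/10 * \<omega>"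
      using mult_mono[of Rp "1/100" \<omega> "5/4"] mult_right_mono[of Rp "1/10" \<omega>] Rp w D(2) by (auto simp: \<rho>0)
    then have "(Rp * \<omega>)\<^sup>2 \<le> 1/10 * (1/10 * \<omega>)"
      using mult_mono[of "Rp * \<omega>" "1/10" "Rp * \<omega>" "1/10 * \<omega>"] by (simp add: power2_eq_square)
    moreover have "0 \<le> \<omega>" using w D(2) by linarith
    ultimately show ?thesis using w(2) by linarith
  qed
  also have "\<dots> \<le> \<omega> * (2 - \<omega>)"
  proof -
    have "\<omega> * (6/10) \<le> \<omega> * (2 - \<omega>)"
      using w D(2) by (intro mult_left_mono) auto
    then show ?thesis by simp
  qed
  also have "\<dots> = 1 - y\<^sup>2"
    by (simp add: \<omega>_def power2_eq_square algebra_simps)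
  finally have disk: "x1\<^sup>2 + y\<^sup>2 \<le> 1" by linarith
  have far: "1/10^7 \<le> sqrt (x1\<^sup>2 + y\<^sup>2)"
  proof (cases "\<bar>y\<bar> \<le> 1/10^7")
    case True
    then have "9/10 \<le> \<omega>" by (auto simp: \<omega>_def abs_le_iff)
    then have "8/10 * R * (9/10) \<le> Rp * \<omega>"
      using Rp(3) by (intro mult_mono) (auto simp: R_def)
    then have "1/10^7 \<le> x1"
      using PE E4 unfolding x1_def R_def by (simp add: abs_le_iff)
    also have "\<dots> \<le> sqrt (x1\<^sup>2 + y\<^sup>2)"
      by (rule real_sqrt_sum_squares_ge1)
    finally show ?thesis .
  next
    case False
    then have "1/10^7 \<le> \<bar>y\<bar>" by simp
    also have "\<dots> \<le> sqrt (x1\<^sup>2 + y\<^sup>2)"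
      by (rule real_le_rsqrt) simp
    finally show ?thesis .
  qed
  have "h i \<le> \<bar>s i * x1 + c i * y - b i\<bar>" if i: "i \<in> I" for i
  proof (cases "i \<in> L")
    case True
    have "Rp * \<omega> \<le> Rp * (1 - \<kappa>)"
      using Rp y by (intro mult_left_mono) (auto simp: \<omega>_def)
    also have "\<dots> = R"
      using \<kappa> by (simp add: Rp_def)
    finally have "\<bar>x1\<bar> \<le> R + 3/2 * E"
      using PE Rp w D(2) by (auto simp: x1_def intro!: order_trans[OF abs_triangle_ineq] add_mono)
    then have "\<bar>s i\<bar> * \<bar>x1\<bar> \<le> \<bar>s i\<bar> * (R + 3/2 * E)"
      by (intro mult_left_mono) auto
    also have "\<dots> \<le> R * \<bar>s i\<bar> + 3/2 * E"
      using unit_vector_coordinates(1)[OF sc[OF i]] E(1) mult_right_mono[of "\<bar>s i\<bar>" 1 "3/2 * E"]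
      by (simp add: algebra_simps)
    finally have "- (R * \<bar>s i\<bar> + 3/2 * E) \<le> s i * x1"
      by (simp add: abs_mult[symmetric] abs_le_iff)
    moreover have "c i * \<kappa> \<le> c i * y"
      using c[OF i] y by (intro mult_left_mono)
    moreover have "b i < c i * \<kappa> - (R * \<bar>s i\<bar> + 3 * E)"
      using True by (simp add: L_def \<xi>_def E_def)
    moreover have "(h i)\<^sup>2 \<le> E\<^sup>2" using h(2)[OF i] E by simp
    then have "h i \<le> E" by (rule power2_le_imp_le) (use E in simp)
    ultimately show ?thesis using E(1) by linarith
  next
    case False
    then have vi: "v i = Rp" by (simp add: v_def)
    define g where "g = (c i - v i * s i)\<^sup>2 + (s i)\<^sup>2"
    have "h i \<le> t i * g"
    proof (cases "i \<in> K")
      case True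
      have "0 < 1 - 2 * \<rho> * \<bar>s i\<bar>" "1 - 2 * \<rho> * \<bar>s i\<bar> \<le> g"
        using inflated_normal(1,4)[OF sc[OF i] c[OF i] vle[of i]] unfolding g_def by (simp_all add: \<rho>0)
      then have "h i * 1 \<le> h i * (g / (1 - 2 * \<rho> * \<bar>s i\<bar>))"
        using h(1)[OF i] by (intro mult_left_mono) auto
      then show ?thesis using True by (simp add: tK tLU)
    next
      case False
      then have "t i = h i / g"
        using i by (simp add: tLU g_def)
      moreover have "9/10 \<le> g"
        unfolding g_def by (rule sheared_normal(1)[OF sc[OF i] c[OF i] vle'[of i]])
      ultimately show ?thesis by simp
    qed
    also have "\<dots> \<le> \<epsilon> i * ((c i - v i * s i) * y + s i * P - (b i - \<bar>v i\<bar> * s i))"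
      using margin[OF i] by (simp add: g_def)
    also have "(c i - v i * s i) * y + s i * P - (b i - \<bar>v i\<bar> * s i) = s i * x1 + c i * y - b i"
      using Rp by (simp add: vi x1_def \<omega>_def algebra_simps)
    also have "\<epsilon> i * (s i * x1 + c i * y - b i) \<le> \<bar>s i * x1 + c i * y - b i\<bar>"
      using \<epsilon>[OF i] by auto
    finally show ?thesis .
  qed
  then show ?thesis
    using disk far by blast
qed

text \<open>
The functionals \<open>fp\<close> and \<open>fm\<close> treat the planks of \<open>U\<close> and of \<open>L\<close> in the same way and those of \<open>K\<close> with the slope
of the upper or lower segment, respectively; \<open>yp\<close> and \<open>ym\<close> are the heights of the points that they produce. Since both segments end
at the kink, \<open>fp - fm = (yp - ym) (yp + ym - 2 \<kappa>)\<close>. The vertical shifts \<open>\<plusminus>\<beta>\<close> are large enough to give \<open>ym < yp\<close>, the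
influence of \<open>K\<close> being \<open>O(R D)\<close>. So if \<open>fp\<close> is the larger one at the maximizer, then \<open>yp \<ge> \<kappa>\<close>, and otherwise
\<open>ym \<le> \<kappa>\<close>. Reflection in the horizontal axis reduces the second case to the first. The hypothesis on the sum over \<open>L\<close>
is the first order condition: this side of the hole is the favourable one.
\<close>
lemma missed_point_given_kink:
  fixes h s c b \<xi> :: "'i \<Rightarrow> real" and D \<kappa> :: real and I K L U :: "'i set"
  assumes \<xi>_def: "\<xi> = (\<lambda>i. 1/1000 * \<bar>s i\<bar> + 3 * sqrt D)"
  assumes L_def: "L = {i \<in> I. b i < c i * \<kappa> - \<xi> i}" and U_def: "U = {i \<in> I. c i * \<kappa> + \<xi> i < b i}"
  assumes K_def: "K = I - (L \<union> U)"
  assumes I: "finite I"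
    and h: "\<And>i. i \<in> I \<Longrightarrow> 0 < h i" "\<And>i. i \<in> I \<Longrightarrow> (h i)\<^sup>2 \<le> D"
    and sc: "\<And>i. i \<in> I \<Longrightarrow> (s i)\<^sup>2 + (c i)\<^sup>2 = 1"
    and c: "\<And>i. i \<in> I \<Longrightarrow> 0 \<le> c i"
    and hs: "(\<Sum>i\<in>I. h i * s i) = 0" and S: "sum h I \<le> 1"
    and D: "D = 1 - (\<Sum>i\<in>I. h i * c i)" "0 < D" "D \<le> 1/10^7"
    and \<kappa>: "\<bar>\<kappa>\<bar> \<le> 1/4"
    and KD: "(\<Sum>i\<in>K. h i * \<bar>s i\<bar>) \<le> 28 * D"
    and side: "0 \<le> (\<Sum>i\<in>L. h i * s i)"
  shows "\<exists>x1 x2. x1\<^sup>2 + x2\<^sup>2 \<le> 1 \<and> 1/10^7 \<le> sqrt (x1\<^sup>2 + x2\<^sup>2) \<and> (\<forall>i\<in>I. h i \<le> \<bar>s i * x1 + c i * x2 - b i\<bar>)"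
proof -
  define R where "R = (1/1000 :: real)"
  define \<rho> where "\<rho> = (1/750 :: real)"
  define \<beta> where "\<beta> = D / 20"
  define Rp where "Rp = R / (1 - \<kappa>)"
  define Rm where "Rm = R / (1 + \<kappa>)"
  define v where "v = (\<lambda>i. if i \<in> L then - Rm else Rp)"
  define v' where "v' = (\<lambda>i. if i \<in> U then Rp else - Rm)"
  define t where "t = (\<lambda>i. if i \<in> K then h i / (1 - 2 * \<rho> * \<bar>s i\<bar>) else h i / ((c i - v i * s i)\<^sup>2 + (s i)\<^sup>2))"
  have xi0: "0 < \<xi> i" for i
    using D(2) by (simp add: \<xi>_def add_nonneg_pos)
  have LU: "i \<notin> U" if "i \<in> L" for i
    using that xi0[of i] by (auto simp: L_def U_def)
  have parts: "L \<subseteq> I" "U \<subseteq> I" "K \<subseteq> I" "L \<inter> U = {}" "I - K = L \<union> U"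
    using LU by (auto simp: L_def U_def K_def)
  have fin: "finite L" "finite U" "finite K"
    using I parts by (auto intro: finite_subset)
  have Rp: "0 < Rp" "Rp \<le> \<rho>" and Rm: "0 < Rm" "Rm \<le> \<rho>" and diff: "Rp - Rm = \<kappa> * (Rp + Rm)"
    using \<kappa> by (auto simp: Rp_def Rm_def R_def \<rho>_def field_simps abs_le_iff)
  have vv: "v i = v' i" if "i \<in> I" "i \<notin> K" for i
    using that LU[of i] by (auto simp: v_def v'_def K_def)
  have vK: "v i = Rp" "v' i = - Rm" if "i \<in> K" for i
    using that by (auto simp: v_def v'_def K_def)
  have vle: "\<bar>v i\<bar> \<le> 1/750" "\<bar>v' i\<bar> \<le> 1/750" for i
    using Rp Rm by (auto simp: v_def v'_def \<rho>_def)
  have t0: "0 < t i" "t i \<le> 101/100 * h i" if "i \<in> I" for i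
  proof -
    show "0 < t i"
      using h(1)[OF that] inflated_normal(1)[OF sc[OF that] c[OF that], of 0 \<rho>]
        sheared_normal(1)[OF sc[OF that] c[OF that] vle(1)[of i]]
      by (auto simp: t_def \<rho>_def intro!: divide_pos_pos)
    have "1 / (1 - 2 * \<rho> * \<bar>s i\<bar>) \<le> 101/100"
      using unit_vector_coordinates(1)[OF sc[OF that]] by (simp add: \<rho>_def field_simps)
    then have "h i * (1 / (1 - 2 * \<rho> * \<bar>s i\<bar>)) \<le> h i * (101/100)"
      using h(1)[OF that] by (intro mult_left_mono) auto
    moreover have "1 / ((c i - v i * s i)\<^sup>2 + (s i)\<^sup>2) \<le> 101/100"
    proof -
      have "\<bar>v i\<bar> * \<bar>s i\<bar> \<le> 1/750 * 1"
        using vle(1)[of i] unit_vector_coordinates(1)[OF sc[OF that]] by (intro mult_mono) auto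
      then have "100/101 \<le> (c i - v i * s i)\<^sup>2 + (s i)\<^sup>2"
        using sheared_normal(4)[OF sc[OF that] c[OF that] vle(1)[of i]] by linarith
      then show ?thesis by (simp add: field_simps)
    qed
    then have "h i * (1 / ((c i - v i * s i)\<^sup>2 + (s i)\<^sup>2)) \<le> h i * (101/100)"
      using h(1)[OF that] by (intro mult_left_mono) auto
    ultimately show "t i \<le> 101/100 * h i"
      by (auto simp: t_def)
  qed

  define yp where "yp = (\<lambda>\<epsilon>. (\<Sum>i\<in>I. \<epsilon> i * (t i * (c i - v i * s i))) + \<beta>)"
  define ym where "ym = (\<lambda>\<epsilon>. (\<Sum>i\<in>I. \<epsilon> i * (t i * (c i - v' i * s i))) + - \<beta>)"
  define P where "P = (\<lambda>\<epsilon>. \<Sum>i\<in>I. \<epsilon> i * (t i * s i))"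
  define np where "np = (\<lambda>\<epsilon>. \<Sum>i\<in>I. \<epsilon> i * (t i * (b i - \<bar>v i\<bar> * s i)))"
  define nm where "nm = (\<lambda>\<epsilon>. \<Sum>i\<in>I. \<epsilon> i * (t i * (b i - \<bar>v' i\<bar> * s i)))"
  define fp where "fp = (\<lambda>\<epsilon>. (yp \<epsilon>)\<^sup>2 + (P \<epsilon>)\<^sup>2 - 2 * np \<epsilon> + - 2 * \<beta> * \<kappa>)"
  define fm where "fm = (\<lambda>\<epsilon>. (ym \<epsilon>)\<^sup>2 + (P \<epsilon>)\<^sup>2 - 2 * nm \<epsilon> + 2 * \<beta> * \<kappa>)"
  define k where "k = (\<lambda>\<epsilon> :: 'i \<Rightarrow> real. \<Sum>i\<in>K. \<epsilon> i * (t i * s i))"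

  have split: "(\<Sum>i\<in>I. f i) = (\<Sum>i\<in>I. g i) + (\<Sum>i\<in>K. f i - g i)"
    if "\<And>i. i \<in> I \<Longrightarrow> i \<notin> K \<Longrightarrow> f i = g i" for f g :: "'i \<Rightarrow> real"
  proof -
    have "(\<Sum>i\<in>I - K. f i) = (\<Sum>i\<in>I - K. g i)"
      using that by (intro sum.cong) auto
    then show ?thesis
      using parts I by (simp add: sum.subset_diff[of K I] sum_subtractf)
  qed
  have yk: "yp \<epsilon> = ym \<epsilon> + (2 * \<beta> - (Rp + Rm) * k \<epsilon>)" for \<epsilon>
  proof -
    have "(\<Sum>i\<in>I. \<epsilon> i * (t i * (c i - v i * s i))) = (\<Sum>i\<in>I. \<epsilon> i * (t i * (c i - v' i * s i)))
        + (\<Sum>i\<in>K. \<epsilon> i * (t i * (c i - v i * s i)) - \<epsilon> i * (t i * (c i - v' i * s i)))"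
      by (rule split) (simp add: vv)
    also have "(\<Sum>i\<in>K. \<epsilon> i * (t i * (c i - v i * s i)) - \<epsilon> i * (t i * (c i - v' i * s i)))
      = (\<Sum>i\<in>K. - (Rp + Rm) * (\<epsilon> i * (t i * s i)))"
      by (intro sum.cong) (simp_all add: vK algebra_simps)
    also have "\<dots> = - (Rp + Rm) * k \<epsilon>"
      by (simp only: k_def sum_distrib_left)
    finally show ?thesis by (simp add: yp_def ym_def algebra_simps)
  qed
  have nk: "np \<epsilon> = nm \<epsilon> - (Rp - Rm) * k \<epsilon>" for \<epsilon>
  proof -
    have "np \<epsilon> = nm \<epsilon> + (\<Sum>i\<in>K. \<epsilon> i * (t i * (b i - \<bar>v i\<bar> * s i)) - \<epsilon> i * (t i * (b i - \<bar>v' i\<bar> * s i)))"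
      unfolding np_def nm_def by (rule split) (simp add: vv)
    also have "(\<Sum>i\<in>K. \<epsilon> i * (t i * (b i - \<bar>v i\<bar> * s i)) - \<epsilon> i * (t i * (b i - \<bar>v' i\<bar> * s i)))
      = (\<Sum>i\<in>K. - (Rp - Rm) * (\<epsilon> i * (t i * s i)))"
      using Rp Rm by (intro sum.cong) (simp_all add: vK algebra_simps)
    also have "\<dots> = - (Rp - Rm) * k \<epsilon>"
      by (simp only: k_def sum_distrib_left)
    finally show ?thesis by (simp add: algebra_simps)
  qed
  have gap: "fp \<epsilon> - fm \<epsilon> = (yp \<epsilon> - ym \<epsilon>) * (yp \<epsilon> + ym \<epsilon> - 2 * \<kappa>)" for \<epsilon>
  proof -
    have "fp \<epsilon> - fm \<epsilon> = (yp \<epsilon>)\<^sup>2 - (ym \<epsilon>)\<^sup>2 + 2 * ((Rp - Rm) * k \<epsilon>) - 4 * \<beta> * \<kappa>"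
      by (simp add: fp_def fm_def nk)
    also have "(yp \<epsilon>)\<^sup>2 - (ym \<epsilon>)\<^sup>2 = (yp \<epsilon> - ym \<epsilon>) * (yp \<epsilon> + ym \<epsilon>)"
      by (simp add: power2_eq_square algebra_simps)
    also have "\<dots> + 2 * ((Rp - Rm) * k \<epsilon>) - 4 * \<beta> * \<kappa> = (yp \<epsilon> - ym \<epsilon>) * (yp \<epsilon> + ym \<epsilon>) - 2 * \<kappa> * (2 * \<beta> - (Rp + Rm) * k \<epsilon>)"
      unfolding diff by (simp add: algebra_simps)
    also have "2 * \<beta> - (Rp + Rm) * k \<epsilon> = yp \<epsilon> - ym \<epsilon>"
      using yk by simp
    finally show ?thesis by (simp add: algebra_simps)
  qed

  obtain \<epsilon> where \<epsilon>: "\<epsilon> \<in> signs I"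
    and max: "\<And>\<epsilon>'. \<epsilon>' \<in> signs I \<Longrightarrow> max (fp \<epsilon>') (fm \<epsilon>') \<le> max (fp \<epsilon>) (fm \<epsilon>)"
    using signs_maximizer[OF I, of "\<lambda>\<epsilon>. max (fp \<epsilon>) (fm \<epsilon>)"] by blast
  have sg: "\<epsilon> i = -1 \<or> \<epsilon> i = 1" if "i \<in> I" for i
    by (rule signs_cases[OF \<epsilon> that])
  have "\<bar>k \<epsilon>\<bar> \<le> (\<Sum>i\<in>K. \<bar>\<epsilon> i * (t i * s i)\<bar>)"
    unfolding k_def by (rule sum_abs)
  also have "\<dots> \<le> (\<Sum>i\<in>K. 101/100 * (h i * \<bar>s i\<bar>))"
  proof (intro sum_mono)
    fix i assume "i \<in> K"
    then have i: "i \<in> I" using parts by blast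
    have "t i * \<bar>s i\<bar> \<le> 101/100 * h i * \<bar>s i\<bar>"
      using t0[OF i] by (intro mult_right_mono) auto
    then show "\<bar>\<epsilon> i * (t i * s i)\<bar> \<le> 101/100 * (h i * \<bar>s i\<bar>)"
      using sg[OF i] t0[OF i] by (auto simp: abs_mult)
  qed
  also have "\<dots> \<le> 101/100 * (28 * D)"
    unfolding sum_distrib_left[symmetric] using KD by (intro mult_left_mono) auto
  finally have "\<bar>k \<epsilon>\<bar> \<le> 101/100 * (28 * D)" .
  then have "(Rp + Rm) * \<bar>k \<epsilon>\<bar> \<le> (2 * \<rho>) * (101/100 * (28 * D))"
    using Rp Rm by (intro mult_mono) (auto simp: \<rho>_def)
  also have "\<dots> < 2 * \<beta>"
    using D(2) by (simp add: \<rho>_def \<beta>_def)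
  finally have "(Rp + Rm) * k \<epsilon> < 2 * \<beta>"
    using mult_left_mono[OF abs_ge_self[of "k \<epsilon>"], of "Rp + Rm"] Rp Rm by linarith
  then have sep: "ym \<epsilon> < yp \<epsilon>"
    using yk[of \<epsilon>] by linarith

  \<comment> \<open>as \<open>\<Sum> h\<^sub>i s\<^sub>i = 0\<close>, the sum over \<open>U\<close> is minus the sum over \<open>L\<close>, up to the planks of \<open>K\<close>\<close>
  have FO: "(\<Sum>i\<in>I - K. h i * (v i * s i)) \<le> 28 * \<rho> * D"
  proof -
    have "(\<Sum>i\<in>I - K. h i * (v i * s i)) = (\<Sum>i\<in>L. h i * (v i * s i)) + (\<Sum>i\<in>U. h i * (v i * s i))"
      unfolding parts using fin parts by (intro sum.union_disjoint) auto
    also have "(\<Sum>i\<in>L. h i * (v i * s i)) = (\<Sum>i\<in>L. - Rm * (h i * s i))"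
      by (intro sum.cong) (auto simp: v_def)
    also have "\<dots> = - Rm * (\<Sum>i\<in>L. h i * s i)"
      by (simp only: sum_distrib_left)
    also have "(\<Sum>i\<in>U. h i * (v i * s i)) = (\<Sum>i\<in>U. Rp * (h i * s i))"
      using LU by (intro sum.cong) (auto simp: v_def)
    also have "\<dots> = Rp * (\<Sum>i\<in>U. h i * s i)"
      by (simp only: sum_distrib_left)
    finally have eq: "(\<Sum>i\<in>I - K. h i * (v i * s i)) = - Rm * (\<Sum>i\<in>L. h i * s i) + Rp * (\<Sum>i\<in>U. h i * s i)" .
    have "0 = (\<Sum>i\<in>I - K. h i * s i) + (\<Sum>i\<in>K. h i * s i)"
      using hs I parts by (simp add: sum.subset_diff[of K I])
    also have "(\<Sum>i\<in>I - K. h i * s i) = (\<Sum>i\<in>L. h i * s i) + (\<Sum>i\<in>U. h i * s i)"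
      unfolding parts using fin parts by (intro sum.union_disjoint) auto
    finally have U: "(\<Sum>i\<in>U. h i * s i) = - (\<Sum>i\<in>L. h i * s i) - (\<Sum>i\<in>K. h i * s i)"
      by linarith
    have "- (\<Sum>i\<in>K. h i * s i) \<le> \<bar>\<Sum>i\<in>K. h i * s i\<bar>" by simp
    also have "\<dots> \<le> (\<Sum>i\<in>K. \<bar>h i * s i\<bar>)" by (rule sum_abs)
    also have "\<dots> = (\<Sum>i\<in>K. h i * \<bar>s i\<bar>)"
      using h(1) parts by (intro sum.cong) (auto simp: abs_mult less_imp_le)
    finally have "(\<Sum>i\<in>U. h i * s i) \<le> 28 * D"
      using U KD side by linarith
    then have "Rp * (\<Sum>i\<in>U. h i * s i) \<le> Rp * (28 * D)"
      using Rp by (intro mult_left_mono) auto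
    also have "\<dots> \<le> \<rho> * (28 * D)"
      using Rp D(2) by (intro mult_right_mono) auto
    finally have "Rp * (\<Sum>i\<in>U. h i * s i) \<le> 28 * \<rho> * D" by simp
    moreover have "0 \<le> Rm * (\<Sum>i\<in>L. h i * s i)"
      using side Rm by (intro mult_nonneg_nonneg) auto
    ultimately show ?thesis
      using eq by linarith
  qed

  show ?thesis
  proof (cases "fm \<epsilon> \<le> fp \<epsilon>")
    case True
    then have "0 \<le> (yp \<epsilon> - ym \<epsilon>) * (yp \<epsilon> + ym \<epsilon> - 2 * \<kappa>)"
      using gap[of \<epsilon>] by linarith
    then have y: "\<kappa> \<le> yp \<epsilon>"
      using sep by (simp add: zero_le_mult_iff)
    have margin: "t i * ((c i - v i * s i)\<^sup>2 + (s i)\<^sup>2)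
                   \<le> \<epsilon> i * ((c i - v i * s i) * yp \<epsilon> + s i * P \<epsilon> - (b i - \<bar>v i\<bar> * s i))" if i: "i \<in> I" for i
    proof -
      have "fp (\<epsilon>(i := - \<epsilon> i)) \<le> fp \<epsilon>"
        using max[OF signs_flip[OF \<epsilon> i]] True by simp
      then show ?thesis
        unfolding fp_def yp_def P_def np_def by (rule bang_step[where t = t and C = "\<lambda>i. c i - v i * s i" and w = s and m = "\<lambda>i. b i - \<bar>v i\<bar> * s i" and \<epsilon> = \<epsilon> and i = i, OF I i \<epsilon> t0(1)[OF i]])
    qed
    show ?thesis
      by (rule missed_point_above_kink[OF R_def \<rho>_def _ L_def U_def K_def Rp_def Rm_def v_def _ _ I sg h sc c hs S D _ _ \<kappa> KD FO
            yp_def[THEN fun_cong] P_def[THEN fun_cong] y margin])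
         (use D(2) in \<open>auto simp: \<xi>_def R_def \<beta>_def t_def\<close>)
  next
    case False
    then have "(yp \<epsilon> - ym \<epsilon>) * (yp \<epsilon> + ym \<epsilon> - 2 * \<kappa>) < 0"
      using gap[of \<epsilon>] by linarith
    then have y: "ym \<epsilon> \<le> \<kappa>"
      using sep by (simp add: mult_less_0_iff)
    have margin: "t i * ((c i - v' i * s i)\<^sup>2 + (s i)\<^sup>2)
                   \<le> \<epsilon> i * ((c i - v' i * s i) * ym \<epsilon> + s i * P \<epsilon> - (b i - \<bar>v' i\<bar> * s i))" if i: "i \<in> I" for i
    proof -
      have "fm (\<epsilon>(i := - \<epsilon> i)) \<le> fm \<epsilon>"
        using max[OF signs_flip[OF \<epsilon> i]] False by simp
      then show ?thesis
        unfolding fm_def ym_def P_def nm_def by (rule bang_step[where t = t and C = "\<lambda>i. c i - v' i * s i" and w = s and m = "\<lambda>i. b i - \<bar>v' i\<bar> * s i" and \<epsilon> = \<epsilon> and i = i, OF I i \<epsilon> t0(1)[OF i]])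
    qed
    have "\<exists>x1 x2. x1\<^sup>2 + x2\<^sup>2 \<le> 1 \<and> 1/10^7 \<le> sqrt (x1\<^sup>2 + x2\<^sup>2) \<and> (\<forall>i\<in>I. h i \<le> \<bar>- s i * x1 + c i * x2 - - b i\<bar>)"
    proof (rule missed_point_above_kink[where s = "\<lambda>i. - s i" and b = "\<lambda>i. - b i" and \<kappa> = "- \<kappa>" and L = U and U = L
          and Rp = Rm and Rm = Rp and v = "\<lambda>i. - v' i" and \<epsilon> = "\<lambda>i. - \<epsilon> i" and y = "- ym \<epsilon>" and P = "P \<epsilon>"
          and t = t and K = K and \<xi> = \<xi>, OF R_def \<rho>_def])
      show "(\<lambda>i. - v' i) = (\<lambda>i. if i \<in> U then - Rp else Rm)"
        by (auto simp: v'_def)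
      show "t i = h i / (1 - 2 * \<rho> * \<bar>- s i\<bar>)" if "i \<in> K" for i
        using that by (simp add: t_def)
      show "t i = h i / ((c i - - v' i * - s i)\<^sup>2 + (- s i)\<^sup>2)" if "i \<in> I - K" for i
        using that vv[of i] by (simp add: t_def)
      show "(\<Sum>i\<in>I - K. h i * (- v' i * - s i)) \<le> 28 * \<rho> * D"
        using FO vv by (simp cong: sum.cong_simp)
      show "- ym \<epsilon> = (\<Sum>i\<in>I. - \<epsilon> i * (t i * (c i - - v' i * - s i))) + \<beta>"
        by (simp add: ym_def sum_negf)
      show "P \<epsilon> = (\<Sum>i\<in>I. - \<epsilon> i * (t i * - s i))"
        by (simp add: P_def)
      show "t i * ((c i - - v' i * - s i)\<^sup>2 + (- s i)\<^sup>2)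
         \<le> - \<epsilon> i * ((c i - - v' i * - s i) * - ym \<epsilon> + - s i * P \<epsilon> - (- b i - \<bar>- v' i\<bar> * - s i))" if "i \<in> I" for i
        using margin[OF that] by (simp add: algebra_simps)
      show "\<xi> = (\<lambda>i. R * \<bar>- s i\<bar> + 3 * sqrt D)"
        by (simp add: \<xi>_def R_def)
      show "U = {i \<in> I. - b i < c i * - \<kappa> - \<xi> i}" "L = {i \<in> I. c i * - \<kappa> + \<xi> i < - b i}" "K = I - (U \<union> L)"
        by (auto simp: U_def L_def K_def)
      show "Rm = R / (1 - - \<kappa>)" "Rp = R / (1 + - \<kappa>)"
        by (simp_all add: Rp_def Rm_def)
      show "(- s i)\<^sup>2 + (c i)\<^sup>2 = 1" "- \<epsilon> i = -1 \<or> - \<epsilon> i = 1" if "i \<in> I" for i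
        using sc[OF that] sg[OF that] by auto
      show "(\<Sum>i\<in>I. h i * - s i) = 0" "(\<Sum>i\<in>K. h i * \<bar>- s i\<bar>) \<le> 28 * D"
        using hs KD by (simp_all add: sum_negf)
      show "0 \<le> \<beta>" "\<beta> \<le> D / 20" "\<bar>- \<kappa>\<bar> \<le> 1/4" "- \<kappa> \<le> - ym \<epsilon>"
        using D(2) \<kappa> y by (simp_all add: \<beta>_def)
    qed (fact I h c S D)+
    then obtain x1 x2 where "x1\<^sup>2 + x2\<^sup>2 \<le> 1" "1/10^7 \<le> sqrt (x1\<^sup>2 + x2\<^sup>2)"
      "\<forall>i\<in>I. h i \<le> \<bar>- s i * x1 + c i * x2 - - b i\<bar>" by blast
    moreover have "\<bar>s i * x1 + c i * - x2 - b i\<bar> = \<bar>- s i * x1 + c i * x2 - - b i\<bar>" for i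
      unfolding abs_eq_iff by simp
    ultimately have "x1\<^sup>2 + (- x2)\<^sup>2 \<le> 1 \<and> 1/10^7 \<le> sqrt (x1\<^sup>2 + (- x2)\<^sup>2) \<and> (\<forall>i\<in>I. h i \<le> \<bar>s i * x1 + c i * - x2 - b i\<bar>)"
      by (simp only: power2_minus)
    then show ?thesis by blast
  qed
qed

section \<open>The choice of the kink\<close>

lemma card_nat_near_le:
  fixes \<alpha> l :: real
  assumes "0 \<le> l"
  shows "real (card {j. j < J \<and> \<bar>real j - \<alpha>\<bar> \<le> l}) \<le> 2 * l + 1"
proof -
  let ?A = "{j. j < J \<and> \<bar>real j - \<alpha>\<bar> \<le> l}" and ?B = "{\<lceil>\<alpha> - l\<rceil>..\<lfloor>\<alpha> + l\<rfloor>}"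
  have "int ` ?A \<subseteq> ?B"
    by (auto simp: ceiling_le_iff le_floor_iff)
  then have "card (int ` ?A) \<le> card ?B"
    by (intro card_mono) auto
  then have "card ?A \<le> nat (\<lfloor>\<alpha> + l\<rfloor> - \<lceil>\<alpha> - l\<rceil> + 1)"
    by (simp add: card_image)
  moreover have "real_of_int (\<lfloor>\<alpha> + l\<rfloor> - \<lceil>\<alpha> - l\<rceil> + 1) \<le> 2 * l + 1"
    using of_int_floor_le[of "\<alpha> + l"] le_of_int_ceiling[of "\<alpha> - l"]
    unfolding of_int_add of_int_diff of_int_1 by linarith
  moreover have "real (nat m) \<le> 2 * l + 1" if "real_of_int m \<le> 2 * l + 1" for m
    using that assms by (cases "0 \<le> m") auto
  ultimately show ?thesis
    by (meson of_nat_le_iff order_trans)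
qed

text \<open>
Average over about \<open>1 / (2 E)\<close> heights with distance \<open>E = sqrt D\<close>. A plank that is not steep is near the kink for a
fraction \<open>O(\<bar>s\<^sub>i\<bar> + E)\<close> of them, so that the average of the sum is \<open>O(\<Sum> h\<^sub>i s\<^sub>i\<^sup>2 + E \<Sum> h\<^sub>i \<bar>s\<^sub>i\<bar>)\<close>. Both
terms are \<open>O(D)\<close>, the second one by Cauchy-Schwarz. A steep plank may be near all of them, but then \<open>\<bar>s\<^sub>i\<bar> \<le> 2 s\<^sub>i\<^sup>2\<close>.
\<close>
lemma exists_kink_height:
  fixes h s c b :: "'i \<Rightarrow> real" and D :: real
  assumes I: "finite I"
    and h: "\<And>i. i \<in> I \<Longrightarrow> 0 < h i"
    and sc: "\<And>i. i \<in> I \<Longrightarrow> (s i)\<^sup>2 + (c i)\<^sup>2 = 1"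
    and c: "\<And>i. i \<in> I \<Longrightarrow> 0 \<le> c i"
    and S: "sum h I \<le> 1"
    and D: "D = 1 - (\<Sum>i\<in>I. h i * c i)" "0 < D"
  obtains \<kappa> where "\<bar>\<kappa>\<bar> \<le> 1/4"
    "(\<Sum>i | i \<in> I \<and> \<bar>b i - c i * \<kappa>\<bar> \<le> 1/1000 * \<bar>s i\<bar> + 3 * sqrt D. h i * \<bar>s i\<bar>) \<le> 28 * D"
proof -
  define E where "E = sqrt D"
  have E: "0 < E" "E\<^sup>2 = D" using D(2) by (auto simp: E_def)
  define J where "J = nat \<lceil>1 / (2 * E)\<rceil>"
  have J: "1 / (2 * E) \<le> real J" "real J < 1 / (2 * E) + 1"
    using E(1) by (auto simp: J_def of_nat_nat) linarith+
  have EJ: "1 / E \<le> 2 * real J"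
    using J(1) E(1) by (simp add: field_simps)
  have J0: "0 < J"
    using J(1) E(1) by (cases "J = 0") (auto simp: field_simps)
  define \<kappa> where "\<kappa> = (\<lambda>j. - 1/4 + real j * E)"
  have \<kappa>: "\<bar>\<kappa> j\<bar> \<le> 1/4" if "j < J" for j
  proof -
    have "real j + 1 \<le> real J" using that by linarith
    then have "real j < 1 / (2 * E)" using J(2) by linarith
    then have "real j * E \<le> 1/2" using E(1) by (simp add: field_simps)
    moreover have "0 \<le> real j * E" using E(1) by simp
    ultimately show ?thesis unfolding \<kappa>_def abs_le_iff by linarith
  qed
  \<comment> \<open>the half-height of the zone around \<open>\<kappa>\<close>, measured along the normal\<close>
  define \<xi> where "\<xi> = (\<lambda>i. 1/1000 * \<bar>s i\<bar> + 3 * E)"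
  define W where "W = (\<lambda>j. \<Sum>i | i \<in> I \<and> \<bar>b i - c i * \<kappa> j\<bar> \<le> \<xi> i. h i * \<bar>s i\<bar>)"
  define n where "n = (\<lambda>i. card {j. j < J \<and> \<bar>b i - c i * \<kappa> j\<bar> \<le> \<xi> i})"

  \<comment> \<open>a plank with \<open>\<bar>s\<^sub>i\<bar> \<le> 1/2\<close> has \<open>c\<^sub>i \<ge> 5/6\<close>, so at most \<open>2 (6/5) \<xi>\<^sub>i / E + 1\<close> heights are near it, and \<open>1 / E \<le> 2 J\<close>\<close>
  have count: "\<bar>s i\<bar> * real (n i) \<le> real J * (2 * (s i)\<^sup>2 + 82/5 * E * \<bar>s i\<bar>)" if i: "i \<in> I" for i
  proof (cases "\<bar>s i\<bar> \<le> 1/2")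
    case True
    then have "(s i)\<^sup>2 \<le> 1/4"
      using power_mono[of "\<bar>s i\<bar>" "1/2" 2] by (simp add: power2_eq_square)
    then have "(5/6)\<^sup>2 \<le> (c i)\<^sup>2"
      using sc[OF i] by (simp add: power2_eq_square)
    then have c56: "5/6 \<le> c i"
      using c[OF i] by (rule power2_le_imp_le)
    have "{j. j < J \<and> \<bar>b i - c i * \<kappa> j\<bar> \<le> \<xi> i} = {j. j < J \<and> \<bar>real j - (b i + c i / 4) / (c i * E)\<bar> \<le> \<xi> i / (c i * E)}"
    proof -
      have "\<bar>b i - c i * \<kappa> j\<bar> \<le> \<xi> i \<longleftrightarrow> \<bar>real j - (b i + c i / 4) / (c i * E)\<bar> \<le> \<xi> i / (c i * E)" for j
      proof -
        have "real j - (b i + c i / 4) / (c i * E) = (c i * \<kappa> j - b i) / (c i * E)"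
          using c56 E(1) by (simp add: \<kappa>_def field_simps)
        then have "\<bar>real j - (b i + c i / 4) / (c i * E)\<bar> = \<bar>b i - c i * \<kappa> j\<bar> / (c i * E)"
          using c56 E(1) by (simp add: abs_minus_commute abs_mult)
        moreover have "0 < c i * E"
          using c56 E(1) by simp
        ultimately show ?thesis
          by (simp add: divide_le_cancel)
      qed
      then show ?thesis by simp
    qed
    then have "real (n i) \<le> 2 * (\<xi> i / (c i * E)) + 1"
      unfolding n_def using card_nat_near_le[of "\<xi> i / (c i * E)" J] c56 E(1) by (simp add: \<xi>_def)
    also have "\<xi> i / (c i * E) \<le> \<xi> i / (5/6 * E)"
      using c56 E(1) by (intro divide_left_mono mult_right_mono) (auto simp: \<xi>_def)
    also have "2 * (\<xi> i / (5/6 * E)) + 1 = 3/1250 * \<bar>s i\<bar> * (1 / E) + 41/5 * (E * (1 / E))"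
      using E(1) by (simp add: \<xi>_def field_simps)
    also have "\<dots> \<le> 3/1250 * \<bar>s i\<bar> * (2 * real J) + 41/5 * (E * (2 * real J))"
      using EJ E(1) by (intro add_mono mult_left_mono) auto
    also have "\<dots> \<le> real J * (2 * \<bar>s i\<bar> + 82/5 * E)"
      by (simp add: algebra_simps mult_right_mono)
    finally have "\<bar>s i\<bar> * real (n i) \<le> \<bar>s i\<bar> * (real J * (2 * \<bar>s i\<bar> + 82/5 * E))"
      by (intro mult_left_mono) auto
    also have "\<dots> = real J * (2 * (s i)\<^sup>2 + 82/5 * E * \<bar>s i\<bar>)"
      by (simp add: power2_eq_square algebra_simps flip: abs_mult)
    finally show ?thesis .
  next
    case False
    then have "\<bar>s i\<bar> \<le> 2 * (s i)\<^sup>2"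
      using mult_right_mono[of "1/2" "\<bar>s i\<bar>" "\<bar>s i\<bar>"] by (simp add: power2_eq_square flip: abs_mult)
    moreover have "n i \<le> card {..<J}"
      unfolding n_def by (intro card_mono) auto
    ultimately have "\<bar>s i\<bar> * real (n i) \<le> 2 * (s i)\<^sup>2 * real J"
      by (intro mult_mono) auto
    also have "\<dots> \<le> real J * (2 * (s i)\<^sup>2 + 82/5 * E * \<bar>s i\<bar>)"
      using E(1) by (simp add: algebra_simps)
    finally show ?thesis .
  qed

  define \<Theta> where "\<Theta> = (\<Sum>i\<in>I. h i * (s i)\<^sup>2)"
  define l where "l = (\<Sum>i\<in>I. h i * \<bar>s i\<bar>)"
  have \<Theta>: "\<Theta> \<le> 2 * D"
    unfolding \<Theta>_def D(1) using h sc c S I by (intro sum_tilt_sq_le) (auto simp: less_imp_le)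
  have "l\<^sup>2 \<le> sum h I * \<Theta>"
    unfolding l_def \<Theta>_def using h by (intro weighted_cauchy_schwarz) (auto simp: less_imp_le)
  also have "\<dots> \<le> 1 * (2 * D)"
    using S \<Theta> h D(2) by (intro mult_mono) (auto simp: \<Theta>_def less_imp_le intro!: sum_nonneg)
  also have "\<dots> \<le> (142/100 * E)\<^sup>2"
    using E D(2) by (simp add: power_mult_distrib power2_eq_square)
  finally have l: "l \<le> 142/100 * E"
    by (rule power2_le_imp_le) (use E(1) in simp)

  have "(\<Sum>j<J. W j) = (\<Sum>j<J. \<Sum>i\<in>I. if \<bar>b i - c i * \<kappa> j\<bar> \<le> \<xi> i then h i * \<bar>s i\<bar> else 0)"
    unfolding W_def using I by (simp add: sum.inter_filter)
  also have "\<dots> = (\<Sum>i\<in>I. \<Sum>j<J. if \<bar>b i - c i * \<kappa> j\<bar> \<le> \<xi> i then h i * \<bar>s i\<bar> else 0)"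
    by (rule sum.swap)
  also have "\<dots> = (\<Sum>i\<in>I. h i * (\<bar>s i\<bar> * real (n i)))"
  proof (intro sum.cong refl)
    fix i
    have "(\<Sum>j<J. if \<bar>b i - c i * \<kappa> j\<bar> \<le> \<xi> i then h i * \<bar>s i\<bar> else 0)
        = (\<Sum>j\<in>{j. j < J \<and> \<bar>b i - c i * \<kappa> j\<bar> \<le> \<xi> i}. h i * \<bar>s i\<bar>)"
      by (subst sum.inter_filter[symmetric]) simp_all
    then show "(\<Sum>j<J. if \<bar>b i - c i * \<kappa> j\<bar> \<le> \<xi> i then h i * \<bar>s i\<bar> else 0) = h i * (\<bar>s i\<bar> * real (n i))"
      by (simp add: n_def)
  qed
  also have "\<dots> \<le> (\<Sum>i\<in>I. h i * (real J * (2 * (s i)\<^sup>2 + 82/5 * E * \<bar>s i\<bar>)))"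
    using count h by (intro sum_mono mult_left_mono) (auto simp: less_imp_le)
  also have "\<dots> = (\<Sum>i\<in>I. real J * (2 * (h i * (s i)\<^sup>2) + 82/5 * E * (h i * \<bar>s i\<bar>)))"
    by (intro sum.cong) (auto simp: algebra_simps)
  also have "\<dots> = real J * (2 * \<Theta> + 82/5 * E * l)"
    by (simp only: \<Theta>_def l_def sum_distrib_left[symmetric] sum.distrib)
  \<comment> \<open>\<open>28 = 4 + 24\<close>, where \<open>82/5 * 142/100 < 24\<close>\<close>
  also have "\<dots> \<le> real J * (28 * D)"
  proof -
    have "E * l \<le> E * (142/100 * E)"
      using l E(1) by (intro mult_left_mono) auto
    then have "E * l \<le> 142/100 * D"
      using E(2) by (simp add: power2_eq_square)
    then have "2 * \<Theta> + 82/5 * (E * l) \<le> 28 * D"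
      using \<Theta> D(2) by linarith
    then show ?thesis
      by (intro mult_left_mono) (auto simp: mult.assoc)
  qed
  finally have tot: "(\<Sum>j<J. W j) \<le> real J * (28 * D)" .
  have "\<exists>j<J. W j \<le> 28 * D"
  proof (rule ccontr)
    assume "\<not> (\<exists>j<J. W j \<le> 28 * D)"
    then have "(\<Sum>j<J. 28 * D) < (\<Sum>j<J. W j)"
      using J0 by (intro sum_strict_mono) auto
    then show False using tot by simp
  qed
  then obtain j where "j < J" "W j \<le> 28 * D" by blast
  then show ?thesis
    using \<kappa>[of j] that[of "\<kappa> j"] unfolding W_def \<xi>_def E_def by blast
qed

section \<open>The missed point\<close>

text \<open>If the sum over \<open>L\<close> has the wrong sign, the broken line passes the hole on the other side.\<close>
lemma missed_point_near_parallel: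
  fixes h s c b :: "'i \<Rightarrow> real" and D :: real
  assumes I: "finite I"
    and h: "\<And>i. i \<in> I \<Longrightarrow> 0 < h i" "\<And>i. i \<in> I \<Longrightarrow> (h i)\<^sup>2 \<le> D"
    and sc: "\<And>i. i \<in> I \<Longrightarrow> (s i)\<^sup>2 + (c i)\<^sup>2 = 1"
    and c: "\<And>i. i \<in> I \<Longrightarrow> 0 \<le> c i"
    and hs: "(\<Sum>i\<in>I. h i * s i) = 0" and S: "sum h I \<le> 1"
    and D: "D = 1 - (\<Sum>i\<in>I. h i * c i)" "0 < D" "D \<le> 1/10^7"
  shows "\<exists>x1 x2. x1\<^sup>2 + x2\<^sup>2 \<le> 1 \<and> 1/10^7 \<le> sqrt (x1\<^sup>2 + x2\<^sup>2) \<and> (\<forall>i\<in>I. h i \<le> \<bar>s i * x1 + c i * x2 - b i\<bar>)"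
proof -
  define \<xi> where "\<xi> = (\<lambda>i. 1/1000 * \<bar>s i\<bar> + 3 * sqrt D)"
  obtain \<kappa> where \<kappa>: "\<bar>\<kappa>\<bar> \<le> 1/4" and K: "(\<Sum>i | i \<in> I \<and> \<bar>b i - c i * \<kappa>\<bar> \<le> \<xi> i. h i * \<bar>s i\<bar>) \<le> 28 * D"
    using exists_kink_height[OF I h(1) sc c S D(1,2), of b] unfolding \<xi>_def by blast
  define L where "L = {i \<in> I. b i < c i * \<kappa> - \<xi> i}"
  define U where "U = {i \<in> I. c i * \<kappa> + \<xi> i < b i}"
  have "I - (L \<union> U) = {i \<in> I. \<bar>b i - c i * \<kappa>\<bar> \<le> \<xi> i}"
    by (auto simp: L_def U_def abs_le_iff)
  then have K': "(\<Sum>i\<in>I - (L \<union> U). h i * \<bar>s i\<bar>) \<le> 28 * D"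
    using K by simp
  show ?thesis
  proof (cases "0 \<le> (\<Sum>i\<in>L. h i * s i)")
    case True
    show ?thesis
      by (rule missed_point_given_kink[OF \<xi>_def L_def U_def refl I h sc c hs S D \<kappa> K' True])
  next
    case False
    have "\<exists>x1 x2. x1\<^sup>2 + x2\<^sup>2 \<le> 1 \<and> 1/10^7 \<le> sqrt (x1\<^sup>2 + x2\<^sup>2) \<and> (\<forall>i\<in>I. h i \<le> \<bar>- s i * x1 + c i * x2 - b i\<bar>)"
      by (rule missed_point_given_kink[where s = "\<lambda>i. - s i", OF _ L_def U_def refl I h _ c _ S D \<kappa>])
        (use sc hs K' False in \<open>auto simp: \<xi>_def sum_negf\<close>)
    then obtain x1 x2 where "x1\<^sup>2 + x2\<^sup>2 \<le> 1" "1/10^7 \<le> sqrt (x1\<^sup>2 + x2\<^sup>2)"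
      "\<forall>i\<in>I. h i \<le> \<bar>- s i * x1 + c i * x2 - b i\<bar>" by blast
    then have "(- x1)\<^sup>2 + x2\<^sup>2 \<le> 1 \<and> 1/10^7 \<le> sqrt ((- x1)\<^sup>2 + x2\<^sup>2) \<and> (\<forall>i\<in>I. h i \<le> \<bar>s i * - x1 + c i * x2 - b i\<bar>)"
      by simp
    then show ?thesis by blast
  qed
qed

text \<open>
The two regimes are distinguished by the largest sum \<open>q = \<Sum> \<epsilon>\<^sub>i h\<^sub>i u\<^sub>i\<close>. In the nearly parallel one, \<open>q\<close> is the vertical axis;
its maximality under single flips gives \<open>c\<^sub>i \<ge> 0\<close> for the oriented normals \<open>\<epsilon>\<^sub>i u\<^sub>i\<close>, and thinness with respect to
the sum of the half-widths implies thinness with respect to \<open>D\<close>.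
\<close>
lemma missed_point_thin_planks:
  fixes u :: "'i \<Rightarrow> real^2" and h b :: "'i \<Rightarrow> real"
  assumes I: "finite I" and u: "\<And>i. i \<in> I \<Longrightarrow> norm (u i) = 1" and h: "\<And>i. i \<in> I \<Longrightarrow> 0 < h i"
    and S: "sum h I < 1" and thin: "\<And>i. i \<in> I \<Longrightarrow> (h i)\<^sup>2 \<le> 1 - sum h I"
  shows "\<exists>x. 1/10^7 \<le> norm x \<and> norm x \<le> 1 \<and> (\<forall>i\<in>I. h i \<le> \<bar>u i \<bullet> x - b i\<bar>)"
proof -
  define p where "p = (\<lambda>\<epsilon>. \<Sum>i\<in>I. \<epsilon> i *\<^sub>R (h i *\<^sub>R u i))"
  obtain \<epsilon> where \<epsilon>: "\<epsilon> \<in> signs I" and max: "\<And>\<epsilon>'. \<epsilon>' \<in> signs I \<Longrightarrow> norm (p \<epsilon>') \<le> norm (p \<epsilon>)"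
    using signs_maximizer[OF I, of "\<lambda>\<epsilon>. norm (p \<epsilon>)"] by blast
  show ?thesis
  proof (cases "norm (p \<epsilon>) \<le> 1 - 1/10^7")
    case True
    have "\<exists>x. 1/10^7 \<le> norm x \<and> norm x \<le> norm (p \<epsilon>) + 1/10^7 \<and> (\<forall>i\<in>I. h i \<le> \<bar>u i \<bullet> x - b i\<bar>)"
      using max by (intro bang_pushed[OF I u h]) (auto simp: p_def)
    then show ?thesis
      using True by fastforce
  next
    case False
    define q where "q = p \<epsilon>"
    have "1 - 1/10^7 < norm q" using False by (simp add: q_def)
    then have q0: "0 < norm q" by (rule less_trans[rotated]) simp
    define e where "e = q /\<^sub>R norm q"
    define f :: "real^2" where "f = vector [e $ 2, - e $ 1]"
    have "norm e = 1" using q0 by (simp add: e_def)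
    then have ee: "(e $ 1)\<^sup>2 + (e $ 2)\<^sup>2 = 1"
      by (simp add: norm_eq_1 inner_vec_def sum_2 power2_eq_square)
    have qe: "q \<bullet> e = norm q" and qf: "q \<bullet> f = 0"
    proof -
      show "q \<bullet> e = norm q"
        using q0 by (simp add: e_def dot_square_norm power2_eq_square)
      show "q \<bullet> f = 0"
        by (simp add: f_def e_def inner_vec_def sum_2)
    qed
    define s where "s = (\<lambda>i. \<epsilon> i * (u i \<bullet> f))"
    define c where "c = (\<lambda>i. \<epsilon> i * (u i \<bullet> e))"
    define D where "D = 1 - norm q"
    have sg: "\<epsilon> i * \<epsilon> i = 1" "\<bar>\<epsilon> i\<bar> = 1" if "i \<in> I" for i
      using signs_cases[OF \<epsilon> that] by auto
    have sum: "(\<Sum>i\<in>I. h i * (\<epsilon> i * (u i \<bullet> w))) = q \<bullet> w" for w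
      by (simp add: q_def p_def inner_sum_left mult_ac)
    have sc: "(s i)\<^sup>2 + (c i)\<^sup>2 = 1" if i: "i \<in> I" for i
    proof -
      have "(s i)\<^sup>2 + (c i)\<^sup>2 = (\<epsilon> i * \<epsilon> i) * ((u i $ 1)\<^sup>2 + (u i $ 2)\<^sup>2) * ((e $ 1)\<^sup>2 + (e $ 2)\<^sup>2)"
        by (simp add: s_def c_def f_def inner_vec_def sum_2 power2_eq_square algebra_simps)
      moreover have "(u i $ 1)\<^sup>2 + (u i $ 2)\<^sup>2 = 1"
        using u[OF i] by (simp add: norm_eq_1 inner_vec_def sum_2 power2_eq_square)
      ultimately show ?thesis using sg[OF i] ee by simp
    qed
    have c0: "0 \<le> c i" if i: "i \<in> I" for i
    proof -
      define d where "d = (2 * \<epsilon> i) *\<^sub>R (h i *\<^sub>R u i)"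
      have "norm (q - d) \<le> norm q"
      proof -
        have "p (\<epsilon>(i := - \<epsilon> i)) = q - d"
          unfolding p_def q_def d_def by (rule sum_flip[OF I i])
        then show ?thesis
          using max[OF signs_flip[OF \<epsilon> i]] by (simp add: q_def)
      qed
      then have "(norm (q - d))\<^sup>2 \<le> (norm q)\<^sup>2"
        by (intro power_mono) auto
      then have "d \<bullet> d \<le> 2 * (q \<bullet> d)"
        by (simp add: power2_norm_eq_inner inner_diff_left inner_diff_right inner_commute)
      then have "0 \<le> q \<bullet> d"
        using inner_ge_zero[of d] by linarith
      also have "q \<bullet> d = (2 * h i * norm q) * c i"
        using q0 by (simp add: d_def c_def e_def inner_commute)
      finally have "0 \<le> (2 * h i * norm q) * c i" .
      moreover have "0 < 2 * h i * norm q" using q0 h[OF i] by simp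
      ultimately show ?thesis by (simp only: zero_le_mult_iff) linarith
    qed
    have "norm q \<le> (\<Sum>i\<in>I. norm (\<epsilon> i *\<^sub>R (h i *\<^sub>R u i)))"
      unfolding q_def p_def by (rule norm_sum)
    also have "\<dots> = sum h I"
      using sg u h by (intro sum.cong) (auto simp: abs_mult less_imp_le)
    finally have qS: "norm q \<le> sum h I" .
    have "\<exists>x1 x2. x1\<^sup>2 + x2\<^sup>2 \<le> 1 \<and> 1/10^7 \<le> sqrt (x1\<^sup>2 + x2\<^sup>2)
            \<and> (\<forall>i\<in>I. h i \<le> \<bar>s i * x1 + c i * x2 - \<epsilon> i * b i\<bar>)"
    proof (rule missed_point_near_parallel[OF I h _ sc c0])
      show "(h i)\<^sup>2 \<le> D" if "i \<in> I" for i
        using thin[OF that] qS by (simp add: D_def)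
      show "(\<Sum>i\<in>I. h i * s i) = 0" "D = 1 - (\<Sum>i\<in>I. h i * c i)"
        using sum qe qf by (simp_all add: s_def c_def D_def)
      show "sum h I \<le> 1" "0 < D" "D \<le> 1/10^7"
        using S qS False by (auto simp: D_def q_def)
    qed
    then obtain x1 x2 where x: "x1\<^sup>2 + x2\<^sup>2 \<le> 1" "1/10^7 \<le> sqrt (x1\<^sup>2 + x2\<^sup>2)"
      "\<And>i. i \<in> I \<Longrightarrow> h i \<le> \<bar>s i * x1 + c i * x2 - \<epsilon> i * b i\<bar>" by blast
    define x where "x = x1 *\<^sub>R f + x2 *\<^sub>R e"
    have "x \<bullet> x = (x1\<^sup>2 + x2\<^sup>2) * ((e $ 1)\<^sup>2 + (e $ 2)\<^sup>2)"
      by (simp add: x_def f_def inner_vec_def sum_2 power2_eq_square algebra_simps)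
    then have nx: "norm x = sqrt (x1\<^sup>2 + x2\<^sup>2)"
      using ee by (simp add: norm_eq_sqrt_inner)
    have "h i \<le> \<bar>u i \<bullet> x - b i\<bar>" if i: "i \<in> I" for i
    proof -
      have "s i * x1 + c i * x2 - \<epsilon> i * b i = \<epsilon> i * (u i \<bullet> x - b i)"
        by (simp add: s_def c_def x_def inner_add_right algebra_simps)
      then show ?thesis
        using x(3)[OF i] sg[OF i] by (simp add: abs_mult)
    qed
    then show ?thesis
      using x(1,2) nx by (intro exI[of _ x]) auto
  qed
qed

lemma in_thin_piece:
  fixes \<tau> h :: real
  assumes "0 \<le> \<tau>" "\<tau> \<le> 2 * h" "0 < N"
  shows "\<exists>j<N. \<bar>\<tau> - (2 * real j + 1) * (h / real N)\<bar> \<le> h / real N"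
proof -
  define w where "w = h / real N"
  have "\<tau> \<le> 2 * (real (N - 1) + 1) * w"
    using assms by (simp add: w_def of_nat_diff)
  then have ex: "\<exists>j. \<tau> \<le> 2 * (real j + 1) * w" by blast
  define j where "j = (LEAST j. \<tau> \<le> 2 * (real j + 1) * w)"
  have j: "\<tau> \<le> 2 * (real j + 1) * w"
    unfolding j_def using ex by (rule LeastI_ex)
  have "j \<le> N - 1"
    unfolding j_def using \<open>\<tau> \<le> 2 * (real (N - 1) + 1) * w\<close> by (rule Least_le)
  then have "j < N" using assms(3) by linarith
  moreover have "2 * real j * w \<le> \<tau>"
  proof (cases j)
    case 0
    then show ?thesis using assms by simp
  next
    case (Suc k)
    then have "\<not> \<tau> \<le> 2 * (real k + 1) * w"
      using not_less_Least[of k "\<lambda>j. \<tau> \<le> 2 * (real j + 1) * w"] by (simp add: j_def)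
    then show ?thesis using Suc by (simp add: add.commute)
  qed
  ultimately show ?thesis
    using j unfolding w_def[symmetric] by (intro exI[of _ j]) (auto simp: abs_le_iff algebra_simps)
qed

text \<open>
Each plank is cut into \<open>N\<close> parallel pieces, whose half-widths are then enlarged by \<open>\<delta>\<close>. The total grows by at most
half of the gap \<open>1 - \<Sum> h\<^sub>i\<close>; a point that is outside of the interior of every enlarged piece is outside of the closed plank.
\<close>
lemma uncovered_point:
  fixes u :: "'i \<Rightarrow> real^2" and h b :: "'i \<Rightarrow> real"
  assumes I: "finite I" and u: "\<And>i. i \<in> I \<Longrightarrow> norm (u i) = 1" and h: "\<And>i. i \<in> I \<Longrightarrow> 0 \<le> h i"
    and S: "sum h I < 1"
  shows "\<exists>x. 1/10^7 \<le> norm x \<and> norm x \<le> 1 \<and> (\<forall>i\<in>I. h i < \<bar>u i \<bullet> x - b i\<bar>)"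
proof -
  define d where "d = (1 - sum h I) / 2"
  have d: "0 < d" "sum h I + d = 1 - d" using S by (auto simp: d_def field_simps)
  define r where "r = sqrt d / 2"
  have r: "0 < r" using d by (simp add: r_def)
  obtain n where n: "inverse (real (Suc n)) < r"
    using reals_Archimedean[OF r] by blast
  define N where "N = Suc n"
  have N: "0 < N" "1 / real N < r" using n by (auto simp: N_def field_simps)
  \<comment> \<open>\<open>Suc\<close> avoids a division by 0 for the empty family\<close>
  define \<delta> where "\<delta> = min r (d / (real (Suc (card I)) * real N))"
  have \<delta>: "0 < \<delta>" "\<delta> \<le> r" "\<delta> \<le> d / (real (Suc (card I)) * real N)"
    using r d N by (auto simp: \<delta>_def)
  define H where "H = (\<lambda>(i, j :: nat). h i / real N + \<delta>)"
  have "sum H (I \<times> {..<N}) = (\<Sum>i\<in>I. \<Sum>j<N. h i / real N + \<delta>)"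
    unfolding H_def by (rule sum.cartesian_product[symmetric])
  also have "\<dots> = sum h I + real (card I) * real N * \<delta>"
    using N(1) by (simp add: sum.distrib distrib_left)
  also have "real (card I) * real N * \<delta> \<le> real (Suc (card I)) * real N * \<delta>"
    using \<delta>(1) by (intro mult_right_mono) auto
  also have "real (Suc (card I)) * real N * \<delta> \<le> d"
    using \<delta>(3) N(1) by (subst (asm) pos_le_divide_eq) (simp_all add: mult.commute del: of_nat_Suc)
  finally have SH: "sum H (I \<times> {..<N}) \<le> 1 - d"
    using d(2) by simp
  have "\<exists>x. 1/10^7 \<le> norm x \<and> norm x \<le> 1 \<and> (\<forall>k\<in>I \<times> {..<N}. H k \<le>
          \<bar>u (fst k) \<bullet> x - (b (fst k) - h (fst k) + (2 * real (snd k) + 1) * (h (fst k) / real N))\<bar>)"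
  proof (rule missed_point_thin_planks)
    show "finite (I \<times> {..<N})" using I by simp
    show "norm (u (fst k)) = 1" if "k \<in> I \<times> {..<N}" for k
      using that u by auto
    show "0 < H k" if "k \<in> I \<times> {..<N}" for k
      using that h \<delta>(1) by (auto simp: H_def intro!: add_nonneg_pos)
    show "sum H (I \<times> {..<N}) < 1" using SH d by linarith
    show "(H k)\<^sup>2 \<le> 1 - sum H (I \<times> {..<N})" if k: "k \<in> I \<times> {..<N}" for k
    proof -
      obtain i j where kij: "k = (i, j)" "i \<in> I" using k by auto
      have "h i \<le> 1"
        using member_le_sum[of i I h] I kij h S by auto
      then have "h i / real N \<le> r"
        using N divide_right_mono[of "h i" 1 "real N"] by linarith
      then have "H k \<le> r + r"
        using \<delta>(2) kij by (simp add: H_def)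
      moreover have "0 \<le> H k"
        using \<delta>(1) h kij by (simp add: H_def)
      ultimately have "H k \<le> sqrt d" "0 \<le> H k"
        by (simp_all add: r_def)
      then have "(H k)\<^sup>2 \<le> (sqrt d)\<^sup>2" by (intro power_mono) auto
      then show ?thesis using SH d by simp
    qed
  qed
  then obtain x where x: "1/10^7 \<le> norm x" "norm x \<le> 1"
    and miss: "\<And>i j. i \<in> I \<Longrightarrow> j < N \<Longrightarrow>
       h i / real N + \<delta> \<le> \<bar>u i \<bullet> x - (b i - h i + (2 * real j + 1) * (h i / real N))\<bar>"
    by (auto simp: H_def)
  have "h i < \<bar>u i \<bullet> x - b i\<bar>" if i: "i \<in> I" for i
  proof (rule ccontr)
    assume "\<not> h i < \<bar>u i \<bullet> x - b i\<bar>"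
    then have "0 \<le> u i \<bullet> x - b i + h i" "u i \<bullet> x - b i + h i \<le> 2 * h i"
      by (auto simp: abs_le_iff not_less)
    then obtain j where j: "j < N" "\<bar>(u i \<bullet> x - b i + h i) - (2 * real j + 1) * (h i / real N)\<bar> \<le> h i / real N"
      using in_thin_piece[OF _ _ N(1)] by blast
    have "u i \<bullet> x - b i + h i - (2 * real j + 1) * (h i / real N) = u i \<bullet> x - (b i - h i + (2 * real j + 1) * (h i / real N))"
      by simp
    then show False
      using miss[OF i j(1)] j(2) \<delta>(1) by linarith
  qed
  then show ?thesis using x by blast
qed

theorem theorem1p1:
  "\<exists>r>0. \<forall>\<P>::(real^2) set set.
     finite \<P> \<longrightarrow> (\<forall>P\<in>\<P>. plank P) \<longrightarrow>
     unit_disk - (\<lambda>x. r *\<^sub>R x) ` unit_disk \<subseteq> \<Union>\<P> \<longrightarrow>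
     (\<Sum>P\<in>\<P>. width P) \<ge> 2"
\<comment> \<open>strictly below \<open>1/10^7\<close>, because the removed disk is closed\<close>
proof (intro exI[of _ "1/10^8 :: real"] conjI allI impI)
  fix \<P> :: "(real^2) set set"
  assume fin: "finite \<P>" and planks: "\<forall>P\<in>\<P>. plank P"
    and cover: "unit_disk - (\<lambda>x. (1/10^8) *\<^sub>R x) ` unit_disk \<subseteq> \<Union>\<P>"
  have "\<forall>P\<in>\<P>. \<exists>u a b. norm u = 1 \<and> a \<le> b \<and> P = slab u a b"
    using planks by (simp add: plank_def)
  then obtain u a b where P: "\<And>P. P \<in> \<P> \<Longrightarrow> norm (u P) = 1 \<and> a P \<le> b P \<and> P = slab (u P) (a P) (b P)"
    by metis
  have w: "width P = b P - a P" if "P \<in> \<P>" for P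
    using P[OF that] width_slab by metis
  show "2 \<le> (\<Sum>P\<in>\<P>. width P)"
  proof (rule ccontr)
    assume "\<not> 2 \<le> (\<Sum>P\<in>\<P>. width P)"
    then have S: "(\<Sum>P\<in>\<P>. (b P - a P) / 2) < 1"
      using w by (simp add: sum_divide_distrib[symmetric])
    obtain x where x: "1/10^7 \<le> norm x" "norm x \<le> 1"
      and miss: "\<And>P. P \<in> \<P> \<Longrightarrow> (b P - a P) / 2 < \<bar>u P \<bullet> x - (a P + b P) / 2\<bar>"
      using uncovered_point[OF fin, of u "\<lambda>P. (b P - a P) / 2" "\<lambda>P. (a P + b P) / 2"] P S by fastforce
    have "x \<notin> (\<lambda>x. (1/10^8) *\<^sub>R x) ` unit_disk"
      using x(1) by auto
    then obtain P where "P \<in> \<P>" "x \<in> P"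
      using cover x(2) by auto
    then have "a P \<le> u P \<bullet> x" "u P \<bullet> x \<le> b P"
      using P[of P] by (auto simp: slab_def)
    then show False
      using miss[OF \<open>P \<in> \<P>\<close>] by (auto simp: abs_if field_simps split: if_splits)
  qed
qed simp

end
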